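(* Let $\preceq$ be a computable well-quasiorder on $\mathbb{N}$. Then $\mathrm{Av}(\preceq)$ is $\nabla$-computably Noetherian.
   Context: A represented space is a pair $\mathbf{X}=(X,\delta_{\mathbf{X}})$ of a set $X$ and a partial surjection $\delta_{\mathbf{X}}:\subseteq\mathbb{N}^{\mathbb{N}}\to X$; if $\delta_{\mathbf{X}}(p)=x$ then $p$ is a name of $x$. A map $f:\mathbf{X}\to\mathbf{Y}$ is computable (continuous) if there is a computable (continuous) partial $F:\subseteq\mathbb{N}^{\mathbb{N}}\to\mathbb{N}^{\mathbb{N}}$ (a realizer) with $\delta_{\mathbf{Y}}(F(p))=f(\delta_{\mathbf{X}}(p))$ for all $p\in\mathrm{dom}(\delta_{\mathbf X})$. Sierpi\'nski space $\mathbb{S}$ has underlying set $\{\top,\bot\}$ and $\delta_{\mathbb{S}}(0^\omega)=\bot$, $\delta_{\mathbb{S}}(p)=\top$ for $p\ne0^\omega$. $\mathcal{C}(\mathbf{X},\mathbf{Y})$ is the represented space of continuous functions, where $nq$ is a name of $f$ if the $n$-th oracle Turing machine with oracle $q$ computes a realizer of $f$. $\mathcal{O}(\mathbf{X})$ is the space of open sets: $U\subseteq X$ is identified with its continuous characteristic function in $\mathcal{C}(\mathbf{X},\mathbb{S})$. $\mathcal{K}(\mathbf{X})$ is the space of saturated compact sets: a set $A\subseteq X$ equal to the intersection of all its open supersets and such that $\{U\in\mathcal{O}(\mathbf{X})\mid A\subseteq U\}\in\mathcal{O}(\mathcal{O}(\mathbf{X}))$ is identified with this element of $\mathcal{O}(\mathcal{O}(\mathbf{X}))$.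 $\Delta:\subseteq\mathbb{N}^{\mathbb{N}}\to\mathbb{N}^{\mathbb{N}}$ is defined on sequences with only finitely many zeros by $\Delta(p)(n)=p(n+1+\max\{i\mid p(i)=0\})-1$ (with $\max\emptyset:=-1$), and $\mathbf{X}^\nabla:=(X,\delta_{\mathbf{X}}\circ\Delta)$. A represented space $\mathbf{X}$ is $\nabla$-computably Noetherian iff the map $\mathrm{id}_{\mathcal{O},\mathcal{K}}:\mathcal{O}(\mathbf{X})\to(\mathcal{K}(\mathbf{X}))^\nabla$, $U\mapsto U$, is well-defined (every open set is compact) and computable. A quasiorder on $\mathbb{N}$ is a reflexive transitive relation $\preceq$; it is computable if $\{(k,n)\mid k\preceq n\}$ is decidable; it is a well-quasiorder if every infinite sequence $(a_n)_{n\in\mathbb{N}}$ has indices $i<j$ with $a_i\preceq a_j$. The represented space $\mathrm{Av}(\preceq)$ has underlying set $\mathbb{N}$ and the representation $\psi_\preceq:\subseteq\mathbb{N}^{\mathbb{N}}\to\mathbb{N}$ defined via $\psi_\preceq(p)=n$ iff $\{k\in\mathbb{N}\mid k\preceq n\}=\{p(i)\mid i\in\mathbb{N}\}$. *)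

theory Defs
  imports "HOL-Analysis.Function_Topology" "HOL-Library.Nat_Bijection" "HOL-Library.FuncSet"
begin

type_synonym baire = "nat \<Rightarrow> nat"


section \<open>Oracle Turing machines\<close>

text \<open>
  Deterministic multi-tape machines given by finite tables of quadruples in the style of Post and
  Davis. A table entry \<open>(s, t, a, act, s')\<close> reads: in state \<open>s\<close>, if the head of tape \<open>t\<close> scans
  the symbol \<open>a\<close>, perform \<open>act\<close> on tape \<open>t\<close> and go to state \<open>s'\<close>. The first
  applicable entry is taken, and the machine halts if there is none. States, tapes and symbols are
  numbered by natural numbers, but a table only mentions finitely many of them. Tapes are infinite to the
  right only; the symbol \<open>0\<close> is the blank.

  Natural numbers are written on tapes in unary. A query replaces the number on a tape by the value
  at this number of one of two given elements of Baire space: the oracle \<open>q\<close>, and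
  the infinite input \<open>p\<close>.
\<close>

datatype action = Left | Right | Query_oracle | Query_input | Write nat

type_synonym transition = "nat \<times> nat \<times> nat \<times> action \<times> nat"

record config =
  state :: nat
  tape :: "nat \<Rightarrow> nat \<Rightarrow> nat"
  head :: "nat \<Rightarrow> nat"

definition unary :: "nat \<Rightarrow> nat \<Rightarrow> nat" where
  "unary m = (\<lambda>i. if i < m then 1 else 0)"

text \<open>The least element below exists, as only finitely many cells are ever non-blank.\<close>

definition unary_value :: "(nat \<Rightarrow> nat) \<Rightarrow> nat" where
  "unary_value T = (LEAST i. T i \<noteq> 1)"

definition answer :: "baire \<Rightarrow> nat \<Rightarrow> config \<Rightarrow> config" where
  "answer r t c = c\<lparr>tape := (tape c)(t := unary (r (unary_value (tape c t)))),
                    head := (head c)(t := 0)\<rparr>"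

text \<open>A head on the leftmost cell stays there when told to move left.\<close>

fun perform :: "baire \<Rightarrow> baire \<Rightarrow> action \<Rightarrow> nat \<Rightarrow> config \<Rightarrow> config" where
  "perform q p Left t c = c\<lparr>head := (head c)(t := head c t - 1)\<rparr>"
| "perform q p Right t c = c\<lparr>head := (head c)(t := head c t + 1)\<rparr>"
| "perform q p (Write b) t c = c\<lparr>tape := (tape c)(t := (tape c t)(head c t := b))\<rparr>"
| "perform q p Query_oracle t c = answer q t c"
| "perform q p Query_input t c = answer p t c"

definition step :: "transition list \<Rightarrow> baire \<Rightarrow> baire \<Rightarrow> config \<Rightarrow> config option" where
  "step M q p c =
     (case find (\<lambda>(s, t, a, act, s'). s = state c \<and> a = tape c t (head c t)) M of
        None \<Rightarrow> None
      | Some (s, t, a, act, s') \<Rightarrow> Some ((perform q p act t c)\<lparr>state := s'\<rparr>))"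

definition init :: "nat \<Rightarrow> config" where
  "init k = \<lparr>state = 0, tape = (\<lambda>_ _. 0)(0 := unary k), head = (\<lambda>_. 0)\<rparr>"

definition halts_with :: "transition list \<Rightarrow> baire \<Rightarrow> baire \<Rightarrow> nat \<Rightarrow> nat \<Rightarrow> bool" where
  "halts_with M q p k v \<longleftrightarrow>
     (\<exists>c. (\<lambda>c c'. step M q p c = Some c')\<^sup>*\<^sup>* (init k) c \<and>
          step M q p c = None \<and> unary_value (tape c 0) = v)"

text \<open>The standard numbering of machines; it is bijective.\<close>

definition decode_action :: "nat \<Rightarrow> action" where
  "decode_action n =
     (if n = 0 then Left else if n = 1 then Right else if n = 2 then Query_oracle
      else if n = 3 then Query_input else Write (n - 4))"

definition decode_transition :: "nat \<Rightarrow> transition" where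
  "decode_transition n =
     (let (s, n1) = prod_decode n; (t, n2) = prod_decode n1; (a, n3) = prod_decode n2;
          (act, s') = prod_decode n3
      in (s, t, a, decode_action act, s'))"

definition machine :: "nat \<Rightarrow> transition list" where
  "machine n = map decode_transition (list_decode n)"

lemma bij_decode_action: "bij decode_action"
proof (rule bijI)
  show "inj decode_action"
    by (rule injI) (auto simp: decode_action_def split: if_splits)
  show "surj decode_action"
  proof (rule surjI)
    fix x
    show "decode_action (case x of Left \<Rightarrow> 0 | Right \<Rightarrow> 1 | Query_oracle \<Rightarrow> 2
            | Query_input \<Rightarrow> 3 | Write b \<Rightarrow> b + 4) = x"
      by (cases x) (auto simp: decode_action_def)
  qed
qed

lemma bij_decode_transition: "bij decode_transition"
proof (rule bijI)
  have inj: "x = y" if "decode_action x = decode_action y" for x y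
    using that bij_decode_action by (auto simp: bij_def inj_def)
  show "inj decode_transition"
    by (rule injI) (auto simp: decode_transition_def Let_def split: prod.splits dest!: inj,
        metis prod_decode_inverse)
  show "surj decode_transition"
  proof (rule surjI)
    fix x :: transition
    obtain s t a act s' where x: "x = (s, t, a, act, s')" by (cases x) auto
    have "decode_action (inv decode_action act) = act"
      using bij_decode_action by (simp add: bij_is_surj surj_f_inv_f)
    then show "decode_transition (case x of (s, t, a, act, s') \<Rightarrow>
        prod_encode (s, prod_encode (t, prod_encode (a,
          prod_encode (inv decode_action act, s'))))) = x"
      by (simp add: x decode_transition_def)
  qed
qed

lemma bij_machine: "bij machine"
proof -
  have "inj (map decode_transition)"
    using bij_decode_transition by (simp add: bij_def inj_mapI)
  moreover have "surj (map decode_transition)"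
    by (rule surjI[of _ "map (inv decode_transition)"])
      (simp add: map_idI bij_is_surj[OF bij_decode_transition] surj_f_inv_f)
  moreover have machine: "machine = map decode_transition \<circ> list_decode"
    by (auto simp: machine_def)
  ultimately show ?thesis
    using bij_list_decode by (simp add: machine bij_comp bijI)
qed


section \<open>Computability and continuity on Baire space\<close>

text \<open>
  The machine produces the \<open>k\<close>-th entry of the output sequence on input \<open>k\<close>.
\<close>

definition machine_fun :: "nat \<Rightarrow> baire \<Rightarrow> baire \<rightharpoonup> baire" where
  "machine_fun n q p =
     (if \<forall>k. \<exists>v. halts_with (machine n) q p k v
      then Some (\<lambda>k. THE v. halts_with (machine n) q p k v) else None)"

text \<open>Machines without an oracle are those with the trivial oracle.\<close>

definition computable_partial :: "(baire \<rightharpoonup> baire) \<Rightarrow> bool" where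
  "computable_partial F \<longleftrightarrow> (\<exists>n. F \<subseteq>\<^sub>m machine_fun n (\<lambda>_. 0))"

definition continuous_partial :: "(baire \<rightharpoonup> baire) \<Rightarrow> bool" where
  "continuous_partial F \<longleftrightarrow> continuous_on (dom F) (\<lambda>p. the (F p))"

definition decidable_rel :: "(nat \<Rightarrow> nat \<Rightarrow> bool) \<Rightarrow> bool" where
  "decidable_rel R \<longleftrightarrow>
     (\<exists>n. \<forall>i j. halts_with (machine n) (\<lambda>_. 0) (\<lambda>_. 0) (prod_encode (i, j)) (if R i j then 1 else 0))"


section \<open>Represented spaces\<close>

text \<open>
  \<open>name X p x\<close> means that \<open>p\<close> is a name of \<open>x\<close>. The representation is kept as a
  relation, so that it may be written down before it is known to be single-valued.
\<close>

record 'a space =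
  points :: "'a set"
  name :: "baire \<Rightarrow> 'a \<Rightarrow> bool"

definition represented_space :: "'a space \<Rightarrow> bool" where
  "represented_space X \<longleftrightarrow>
     (\<forall>p x. name X p x \<longrightarrow> x \<in> points X) \<and>
     (\<forall>p x y. name X p x \<longrightarrow> name X p y \<longrightarrow> x = y) \<and>
     (\<forall>x\<in>points X. \<exists>p. name X p x)"

definition realizes :: "(baire \<rightharpoonup> baire) \<Rightarrow> 'a space \<Rightarrow> 'b space \<Rightarrow> ('a \<Rightarrow> 'b) \<Rightarrow> bool" where
  "realizes F X Y f \<longleftrightarrow> (\<forall>p x. name X p x \<longrightarrow> (\<exists>r. F p = Some r \<and> name Y r (f x)))"

definition computable_between :: "'a space \<Rightarrow> 'b space \<Rightarrow> ('a \<Rightarrow> 'b) \<Rightarrow> bool" where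
  "computable_between X Y f \<longleftrightarrow>
     f \<in> points X \<rightarrow> points Y \<and> (\<exists>F. computable_partial F \<and> realizes F X Y f)"

definition continuous_between :: "'a space \<Rightarrow> 'b space \<Rightarrow> ('a \<Rightarrow> 'b) \<Rightarrow> bool" where
  "continuous_between X Y f \<longleftrightarrow>
     f \<in> points X \<rightarrow> points Y \<and> (\<exists>F. continuous_partial F \<and> realizes F X Y f)"

text \<open>The truth values \<open>True\<close> and \<open>False\<close> are the points top and bottom.\<close>

definition Sierpinski :: "bool space" where
  "Sierpinski = \<lparr>points = UNIV, name = (\<lambda>p b. b \<longleftrightarrow> p \<noteq> (\<lambda>_. 0))\<rparr>"

definition function_space :: "'a space \<Rightarrow> 'b space \<Rightarrow> ('a \<Rightarrow> 'b) space" where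
  "function_space X Y =
     (let C = {f \<in> extensional (points X). continuous_between X Y f}
      in \<lparr>points = C,
          name = (\<lambda>p f. f \<in> C \<and> realizes (machine_fun (p 0) (\<lambda>i. p (Suc i))) X Y f)\<rparr>)"

definition char_fun :: "'a space \<Rightarrow> 'a set \<Rightarrow> 'a \<Rightarrow> bool" where
  "char_fun X U = restrict (\<lambda>x. x \<in> U) (points X)"

definition opens :: "'a space \<Rightarrow> 'a set space" where
  "opens X =
     \<lparr>points = {U. U \<subseteq> points X \<and> char_fun X U \<in> points (function_space X Sierpinski)},
      name = (\<lambda>p U. U \<subseteq> points X \<and> name (function_space X Sierpinski) p (char_fun X U))\<rparr>"

definition open_supersets :: "'a space \<Rightarrow> 'a set \<Rightarrow> 'a set set" where
  "open_supersets X A = {U \<in> points (opens X). A \<subseteq> U}"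

definition compacts :: "'a space \<Rightarrow> 'a set space" where
  "compacts X =
     (let K = {A. A \<subseteq> points X \<and> A = \<Inter>(open_supersets X A) \<and>
                  open_supersets X A \<in> points (opens (opens X))}
      in \<lparr>points = K,
          name = (\<lambda>p A. A \<in> K \<and> name (opens (opens X)) p (open_supersets X A))\<rparr>)"


section \<open>Computability with finitely many mind changes\<close>

definition Delta :: "baire \<rightharpoonup> baire" where
  "Delta p =
     (let Z = {i. p i = 0}
      in if finite Z then Some (\<lambda>n. p (n + (if Z = {} then 0 else 1 + Max Z)) - 1) else None)"

definition nabla :: "'a space \<Rightarrow> 'a space" where
  "nabla X = \<lparr>points = points X, name = (\<lambda>p x. \<exists>r. Delta p = Some r \<and> name X r x)\<rparr>"

definition nabla_computably_Noetherian :: "'a space \<Rightarrow> bool" where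
  "nabla_computably_Noetherian X \<longleftrightarrow>
     points (opens X) \<subseteq> points (compacts X) \<and>
     computable_between (opens X) (nabla (compacts X)) (\<lambda>U. U)"


section \<open>Well-quasiorders on the natural numbers\<close>

definition quasiorder :: "(nat \<Rightarrow> nat \<Rightarrow> bool) \<Rightarrow> bool" where
  "quasiorder le \<longleftrightarrow> reflp le \<and> transp le"

definition well_quasiorder :: "(nat \<Rightarrow> nat \<Rightarrow> bool) \<Rightarrow> bool" where
  "well_quasiorder le \<longleftrightarrow> quasiorder le \<and> (\<forall>a :: nat \<Rightarrow> nat. \<exists>i j. i < j \<and> le (a i) (a j))"

text \<open>
  If \<open>le\<close> is not antisymmetric, equivalent numbers have the same names, and the representation is
  single-valued only up to this equivalence. All notions above make sense for such
  a naming relation; the open sets are then automatically closed under equivalence, so that nothing changes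
  when passing to the quotient.
\<close>

definition Av :: "(nat \<Rightarrow> nat \<Rightarrow> bool) \<Rightarrow> nat space" where
  "Av le = \<lparr>points = UNIV, name = (\<lambda>p n. {k. le k n} = range p)\<rparr>"

lemma represented_space_Av:
  assumes "quasiorder le"
  shows "represented_space (Av le) \<longleftrightarrow> antisymp le"
proof -
  have refl: "le n n" and trans: "le k m \<Longrightarrow> le m n \<Longrightarrow> le k n" for k m n
    using assms by (auto simp: quasiorder_def dest: reflpD transpD)
  have "\<exists>p :: baire. {k. le k n} = range p" for n
    by (rule exI[of _ "\<lambda>i. if le i n then i else n"]) (auto simp: refl)
  moreover have "{k. le k m} = {k. le k n} \<longleftrightarrow> le m n \<and> le n m" for m n
    using refl trans by blast
  ultimately show ?thesis
    unfolding represented_space_def Av_def antisymp_def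
    by simp metis
qed

end

theory Submission imports Defs begin

text \<open>
  An open set \<open>U\<close> of \<open>Av le\<close> is upward closed, because every finite prefix of a name of \<open>x\<close> extends to a name
  of each \<open>y\<close> above \<open>x\<close>. A machine that is given a name of \<open>U\<close> tests each \<open>x\<close> for membership in \<open>U\<close> by running the
  name of \<open>U\<close> on a canonical name of \<open>x\<close>, for more and more steps, and collects a new element when it has found
  that no earlier element lies below it. The collected elements form a bad sequence, so
  the well-quasiorder allows only finitely many of them, and each addition is one mind change. The final
  finite set \<open>B\<close> generates \<open>U\<close>; hence \<open>U \<subseteq> V\<close> iff \<open>B \<subseteq> V\<close> for every open \<open>V\<close>, which is semidecidable
  in \<open>B\<close> and a name of \<open>V\<close>.

  Bounding the number of simulated steps by the stage makes everything involved primitive recursive in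
  the given sequences; no unbounded search has to be programmed.
\<close>

section \<open>Compiling register programs to machines\<close>

datatype com = Skip | Inc nat | Dec nat | Ask_oracle nat | Ask_input nat
  | Seq com com (infixr ";;" 60) | Cond nat com com | While nat com

inductive exec :: "baire \<Rightarrow> baire \<Rightarrow> com \<Rightarrow> (nat \<Rightarrow> nat) \<Rightarrow> (nat \<Rightarrow> nat) \<Rightarrow> bool"
  for q p where
  Skip: "exec q p Skip e e"
| Inc: "exec q p (Inc t) e (e(t := Suc (e t)))"
| Dec: "exec q p (Dec t) e (e(t := e t - 1))"
| Ask_oracle: "exec q p (Ask_oracle t) e (e(t := q (e t)))"
| Ask_input: "exec q p (Ask_input t) e (e(t := p (e t)))"
| Seq: "exec q p c e e' \<Longrightarrow> exec q p d e' e'' \<Longrightarrow> exec q p (c ;; d) e e''"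
| Cond_nonzero: "e t \<noteq> 0 \<Longrightarrow> exec q p c e e' \<Longrightarrow> exec q p (Cond t c d) e e'"
| Cond_zero: "e t = 0 \<Longrightarrow> exec q p d e e' \<Longrightarrow> exec q p (Cond t c d) e e'"
| While_done: "e t = 0 \<Longrightarrow> exec q p (While t c) e e"
| While_loop: "e t \<noteq> 0 \<Longrightarrow> exec q p c e e' \<Longrightarrow> exec q p (While t c) e' e'' \<Longrightarrow>
    exec q p (While t c) e e''"

text \<open>The number of states reserved for the code: \<open>compile s c\<close> occupies the
  states from \<open>s\<close> up to, but excluding, the exit state
  \<open>s + len c\<close>.\<close>

fun len :: "com \<Rightarrow> nat" where
  "len Skip = 0"
| "len (Inc t) = 1"
| "len (Dec t) = 2"
| "len (Ask_oracle t) = 1"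
| "len (Ask_input t) = 1"
| "len (c ;; d) = len c + len d"
| "len (Cond t c d) = len c + len d + 3"
| "len (While t c) = len c + 3"

text \<open>
  A register \<open>t\<close> with content \<open>m\<close> is the tape \<open>t\<close> with content \<open>unary m\<close>, the head being
  anywhere on the first \<open>m + 1\<close> cells. Since a head cannot notice the left end of its tape, every operation
  first runs to the first blank; one move to the left from there reads a blank iff \<open>m = 0\<close>.
\<close>

definition test :: "nat \<Rightarrow> nat \<Rightarrow> nat \<Rightarrow> nat \<Rightarrow> transition list" where
  "test s t s1 s0 = [(s, t, 1, Right, s), (s, t, 0, Left, s + 1),
     (s + 1, t, 1, Write 1, s1), (s + 1, t, 0, Write 0, s0)]"

text \<open>No action leaves a tape alone, so a jump writes back the symbol that it has just
  scanned.\<close>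

definition goto :: "nat \<Rightarrow> nat \<Rightarrow> nat \<Rightarrow> transition list" where
  "goto s t s' = [(s, t, 0, Write 0, s'), (s, t, 1, Write 1, s')]"

fun compile :: "nat \<Rightarrow> com \<Rightarrow> transition list" where
  "compile s Skip = []"
| "compile s (Inc t) = [(s, t, 1, Right, s), (s, t, 0, Write 1, s + 1)]"
| "compile s (Dec t) = [(s, t, 1, Right, s), (s, t, 0, Left, s + 1),
     (s + 1, t, 1, Write 0, s + 2), (s + 1, t, 0, Write 0, s + 2)]"
| "compile s (Ask_oracle t) = [(s, t, 0, Query_oracle, s + 1), (s, t, 1, Query_oracle, s + 1)]"
| "compile s (Ask_input t) = [(s, t, 0, Query_input, s + 1), (s, t, 1, Query_input, s + 1)]"
| "compile s (c ;; d) = compile s c @ compile (s + len c) d"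
| "compile s (Cond t c d) = test s t (s + 2) (s + len c + 3) @ compile (s + 2) c @
     goto (s + len c + 2) t (s + len c + len d + 3) @ compile (s + len c + 3) d"
| "compile s (While t c) = test s t (s + 2) (s + len c + 3) @ compile (s + 2) c @
     goto (s + len c + 2) t s"

text \<open>At most one entry can apply to a configuration, so the order of the table is immaterial
  and code fragments may be studied inside any larger table.\<close>

definition deterministic :: "transition list \<Rightarrow> bool" where
  "deterministic M \<longleftrightarrow> (\<forall>s x y. (s, x) \<in> set M \<longrightarrow> (s, y) \<in> set M \<longrightarrow>
     fst x = fst y \<and> (fst (snd x) = fst (snd y) \<longrightarrow> x = y))"

lemma compile_states:
  "(s', x) \<in> set (compile s c) \<Longrightarrow> s \<le> s' \<and> s' < s + len c"
proof (induction c arbitrary: s)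
  case (Seq c d)
  then show ?case by fastforce
next
  case (Cond t c d)
  then show ?case by (fastforce simp: test_def goto_def)
next
  case (While t c)
  then show ?case by (fastforce simp: test_def goto_def)
qed auto

lemma deterministic_append:
  assumes "deterministic M" "deterministic N"
    and "\<And>s x y. (s, x) \<in> set M \<Longrightarrow> (s, y) \<in> set N \<Longrightarrow> False"
  shows "deterministic (M @ N)"
  using assms unfolding deterministic_def set_append Un_iff by blast

lemma deterministic_test: "s1 \<noteq> s \<Longrightarrow> s0 \<noteq> s \<Longrightarrow> deterministic (test s t s1 s0)"
  unfolding deterministic_def test_def by auto

lemma deterministic_goto: "deterministic (goto s t s')"
  unfolding deterministic_def goto_def by auto

lemma deterministic_compile: "deterministic (compile s c)"
proof (induction c arbitrary: s)
  case (Seq c d)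
  show ?case
    unfolding compile.simps
    by (intro deterministic_append Seq) (auto dest!: compile_states)
next
  case (Cond t c d)
  show ?case
    unfolding compile.simps
    by (intro deterministic_append Cond deterministic_test deterministic_goto)
      (auto dest!: compile_states simp: test_def goto_def)
next
  case (While t c)
  show ?case
    unfolding compile.simps
    by (intro deterministic_append While deterministic_test deterministic_goto)
      (auto dest!: compile_states simp: test_def goto_def)
qed (auto simp: deterministic_def)

section \<open>Correctness of the compilation\<close>

abbreviation steps :: "transition list \<Rightarrow> baire \<Rightarrow> baire \<Rightarrow> config \<Rightarrow> config \<Rightarrow> bool" where
  "steps M q p \<equiv> (\<lambda>c c'. step M q p c = Some c')\<^sup>*\<^sup>*"

lemma step_deterministic:
  assumes "deterministic M" "(s, t, a, act, s') \<in> set M" "state k = s" "tape k t (head k t) = a"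
  shows "step M q p k = Some ((perform q p act t k)\<lparr>state := s'\<rparr>)"
proof -
  let ?P = "\<lambda>(s, t, a, act, s'). s = state k \<and> a = tape k t (head k t)"
  have "find ?P M \<noteq> None"
    using assms(2-4) by (auto simp: find_None_iff)
  then obtain y where y: "find ?P M = Some y" by auto
  then have "y \<in> set M" "?P y"
    by (auto simp: find_Some_iff dest: nth_mem)
  moreover obtain t2 a2 r where "y = (s, t2, a2, r)" "a2 = tape k t2 (head k t2)"
    using \<open>?P y\<close> assms(3) by (cases y) auto
  moreover have "t2 = t \<and> (a2 = a \<longrightarrow> (t2, a2, r) = (t, a, act, s'))"
    using assms(1)[unfolded deterministic_def] assms(2) calculation by force
  ultimately have "y = (s, t, a, act, s')"
    using assms(4) by auto
  then show ?thesis
    using y by (simp add: step_def)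
qed

definition rep :: "(nat \<Rightarrow> nat) \<Rightarrow> config \<Rightarrow> bool" where
  "rep e k \<longleftrightarrow> (\<forall>t. tape k t = unary (e t) \<and> head k t \<le> e t)"

lemma unary_value_unary [simp]: "unary_value (unary m) = m"
  unfolding unary_value_def unary_def
  by (rule Least_equality) (simp, metis not_less)

lemma unary_Suc: "(unary m)(m := 1) = unary (Suc m)"
  by (auto simp: unary_def)

lemma unary_pred: "(unary m)(m - 1 := 0) = unary (m - 1)"
  by (rule ext) (auto simp: unary_def)

lemma state_perform [simp]:
  "state (perform q p act t k) = state k"
  by (cases act) (auto simp: answer_def)

lemma steps_single: "step M q p k = Some k' \<Longrightarrow> steps M q p k k'"
  by (rule r_into_rtranclp)

lemma steps_Cons: "step M q p k = Some k1 \<Longrightarrow> steps M q p k1 k2 \<Longrightarrow> steps M q p k k2"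
  by (rule converse_rtranclp_into_rtranclp)

context
  fixes M :: "transition list" and q p :: baire
  assumes det: "deterministic M"
begin

text \<open>Induction on the distance from the head to the first blank; every cell on the way
  contains 1.\<close>

lemma seek:
  assumes "(s, t, 1, Right, s) \<in> set M" "state k = s" "rep e k"
  shows "\<exists>k'. steps M q p k k' \<and> state k' = s \<and> rep e k' \<and> head k' t = e t"
  using assms
proof (induction "e t - head k t" arbitrary: k)
  case 0
  then have "head k t = e t"
    by (auto simp: rep_def intro: le_antisym)
  then show ?case
    using 0 by blast
next
  case (Suc n)
  let ?k = "(perform q p Right t k)\<lparr>state := s\<rparr>"
  have "tape k t (head k t) = 1"
    using Suc.hyps(2) Suc.prems(3) by (auto simp: rep_def unary_def)
  then have "step M q p k = Some ?k"
    using step_deterministic[OF det Suc.prems(1,2)] by blast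
  moreover have "\<exists>k'. steps M q p ?k k' \<and> state k' = s \<and> rep e k' \<and> head k' t = e t"
  proof (rule Suc.hyps(1))
    show "n = e t - head ?k t" using Suc.hyps(2) by simp
    have "head k t < e t" using Suc.hyps(2) by simp
    then show "rep e ?k" using Suc.prems(3) by (auto simp: rep_def)
  qed (use Suc.prems in auto)
  ultimately show ?case
    using steps_Cons by blast
qed

text \<open>For \<open>e t = 0\<close> the head stays on the leftmost cell, in agreement with
  truncated subtraction.\<close>

lemma seek_last:
  assumes "(s, t, 1, Right, s) \<in> set M" "(s, t, 0, Left, s + 1) \<in> set M" "state k = s" "rep e k"
  shows "\<exists>k'. steps M q p k k' \<and> state k' = s + 1 \<and> rep e k' \<and> head k' t = e t - 1"
proof -
  obtain k1 where k1: "steps M q p k k1" "state k1 = s" "rep e k1" "head k1 t = e t"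
    using seek assms by blast
  then have "tape k1 t (head k1 t) = 0"
    by (auto simp: rep_def unary_def)
  note st = step_deterministic[OF det assms(2) k1(2) this]
  have "rep e ((perform q p Left t k1)\<lparr>state := s + 1\<rparr>)"
    using k1(3,4) by (auto simp: rep_def)
  then show ?thesis
    using rtranclp.rtrancl_into_rtrancl[OF k1(1) st] k1(4) by fastforce
qed

lemma goto_correct:
  assumes "set (goto s t s') \<subseteq> set M" "state k = s" "rep e k"
  shows "\<exists>k'. steps M q p k k' \<and> state k' = s' \<and> rep e k'"
proof -
  let ?a = "tape k t (head k t)"
  have "?a = 0 \<or> ?a = 1"
    using assms(3) by (auto simp: rep_def unary_def)
  then have "(s, t, ?a, Write ?a, s') \<in> set M"
    using assms(1) by (auto simp: goto_def)
  from step_deterministic[OF det this assms(2) refl]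
  have "step M q p k = Some (k\<lparr>state := s'\<rparr>)"
    by simp
  moreover have "rep e (k\<lparr>state := s'\<rparr>)"
    using assms(3) by (auto simp: rep_def)
  ultimately show ?thesis
    by (metis (no_types, lifting) steps_single config.select_convs(1) config.update_convs(1) config.surjective)
qed

lemma test_correct:
  assumes "set (test s t s1 s0) \<subseteq> set M" "state k = s" "rep e k"
  shows "\<exists>k'. steps M q p k k' \<and> state k' = (if e t = 0 then s0 else s1) \<and> rep e k'"
proof -
  obtain k1 where k1: "steps M q p k k1" "state k1 = s + 1" "rep e k1" "head k1 t = e t - 1"
    using seek_last[of s t k e] assms by (auto simp: test_def)
  let ?a = "tape k1 t (head k1 t)" and ?s = "if e t = 0 then s0 else s1"
  have "?a = (if e t = 0 then 0 else 1)"
    using k1(3,4) by (auto simp: rep_def unary_def)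
  then have "(s + 1, t, ?a, Write ?a, ?s) \<in> set M"
    using assms(1) by (auto simp: test_def)
  from step_deterministic[OF det this k1(2) refl]
  have "step M q p k1 = Some (k1\<lparr>state := ?s\<rparr>)"
    by simp
  moreover have "rep e (k1\<lparr>state := ?s\<rparr>)" "state (k1\<lparr>state := ?s\<rparr>) = ?s"
    using k1(3) by (auto simp: rep_def)
  ultimately show ?thesis
    using k1(1) by (meson rtranclp.rtrancl_into_rtrancl)
qed

text \<open>The code is only required to be part of \<open>M\<close>. This lets the induction over
  the execution treat subprograms at shifted states without changing the machine.\<close>

lemma compile_correct:
  assumes "exec q p c e e'" "set (compile s c) \<subseteq> set M" "state k = s" "rep e k"
  shows "\<exists>k'. steps M q p k k' \<and> state k' = s + len c \<and> rep e' k'"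
  using assms
proof (induction arbitrary: s k rule: exec.induct)
  case (Skip e)
  then show ?case by auto
next
  case (Inc t e)
  obtain k1 where k1: "steps M q p k k1" "state k1 = s" "rep e k1" "head k1 t = e t"
    using seek[of s t k e] Inc by auto
  have "(s, t, 0, Write 1, s + 1) \<in> set M" "tape k1 t (head k1 t) = 0"
    using Inc k1 by (auto simp: rep_def unary_def)
  note st = step_deterministic[OF det this(1) k1(2) this(2)]
  have "rep (e(t := Suc (e t))) ((perform q p (Write 1) t k1)\<lparr>state := s + 1\<rparr>)"
    using k1(3,4) unary_Suc by (auto simp: rep_def)
  then show ?case
    using rtranclp.rtrancl_into_rtrancl[OF k1(1) st] by fastforce
next
  case (Dec t e)
  obtain k1 where k1: "steps M q p k k1" "state k1 = s + 1" "rep e k1" "head k1 t = e t - 1"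
    using seek_last[of s t k e] Dec by auto
  have "(s + 1, t, tape k1 t (head k1 t), Write 0, s + 2) \<in> set M"
    using Dec k1 by (auto simp: rep_def unary_def)
  note st = step_deterministic[OF det this k1(2) refl]
  have "rep (e(t := e t - 1)) ((perform q p (Write 0) t k1)\<lparr>state := s + 2\<rparr>)"
    using k1(3,4) unary_pred by (auto simp: rep_def)
  then show ?case
    using rtranclp.rtrancl_into_rtrancl[OF k1(1) st] by fastforce
next
  case (Ask_oracle t e)
  have "(s, t, tape k t (head k t), Query_oracle, s + 1) \<in> set M"
    using Ask_oracle by (auto simp: rep_def unary_def)
  note st = step_deterministic[OF det this Ask_oracle(2) refl]
  have "rep (e(t := q (e t))) ((perform q p Query_oracle t k)\<lparr>state := s + 1\<rparr>)"
    using Ask_oracle(3) by (auto simp: rep_def answer_def)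
  then show ?case
    using steps_single[OF st] by fastforce
next
  case (Ask_input t e)
  have "(s, t, tape k t (head k t), Query_input, s + 1) \<in> set M"
    using Ask_input by (auto simp: rep_def unary_def)
  note st = step_deterministic[OF det this Ask_input(2) refl]
  have "rep (e(t := p (e t))) ((perform q p Query_input t k)\<lparr>state := s + 1\<rparr>)"
    using Ask_input(3) by (auto simp: rep_def answer_def)
  then show ?case
    using steps_single[OF st] by fastforce
next
  case (Seq c e e' d e'')
  have "set (compile s c) \<subseteq> set M" "set (compile (s + len c) d) \<subseteq> set M"
    using Seq.prems(1) by auto
  then obtain k1 where k1: "steps M q p k k1" "state k1 = s + len c" "rep e' k1"
    using Seq.IH(1) Seq.prems by blast
  obtain k2 where "steps M q p k1 k2" "state k2 = s + len c + len d" "rep e'' k2"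
    using Seq.IH(2)[OF _ k1(2,3)] \<open>set (compile (s + len c) d) \<subseteq> set M\<close> by blast
  then show ?case
    using rtranclp_trans[OF k1(1)] by (auto simp: add_ac)
next
  case (Cond_nonzero e t c e' d)
  have sub: "set (test s t (s + 2) (s + len c + 3)) \<subseteq> set M" "set (compile (s + 2) c) \<subseteq> set M"
    "set (goto (s + len c + 2) t (s + len c + len d + 3)) \<subseteq> set M"
    using Cond_nonzero.prems(1) by auto
  obtain k1 where k1: "steps M q p k k1" "state k1 = s + 2" "rep e k1"
    using test_correct[OF sub(1) Cond_nonzero.prems(2,3)] Cond_nonzero.hyps(1) by auto
  obtain k2 where k2: "steps M q p k1 k2" "state k2 = s + 2 + len c" "rep e' k2"
    using Cond_nonzero.IH[OF sub(2) k1(2,3)] by auto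
  have "state k2 = s + len c + 2" using k2(2) by simp
  from goto_correct[OF sub(3) this k2(3)] show ?case
    using rtranclp_trans[OF rtranclp_trans[OF k1(1) k2(1)]] by (auto simp: add_ac)
next
  case (Cond_zero e t d e' c)
  have sub: "set (test s t (s + 2) (s + len c + 3)) \<subseteq> set M"
    "set (compile (s + len c + 3) d) \<subseteq> set M"
    using Cond_zero.prems(1) by auto
  obtain k1 where k1: "steps M q p k k1" "state k1 = s + len c + 3" "rep e k1"
    using test_correct[OF sub(1) Cond_zero.prems(2,3)] Cond_zero.hyps(1) by auto
  from Cond_zero.IH[OF sub(2) k1(2,3)] show ?case
    using rtranclp_trans[OF k1(1)] by (auto simp: add_ac)
next
  case (While_done e t c)
  have sub: "set (test s t (s + 2) (s + len c + 3)) \<subseteq> set M"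
    using While_done.prems(1) by auto
  from test_correct[OF this While_done.prems(2,3)] While_done.hyps(1) show ?case
    by (auto simp: add_ac)
next
  case (While_loop e t c e' e'')
  have sub: "set (test s t (s + 2) (s + len c + 3)) \<subseteq> set M" "set (compile (s + 2) c) \<subseteq> set M"
    "set (goto (s + len c + 2) t s) \<subseteq> set M"
    using While_loop.prems(1) by auto
  obtain k1 where k1: "steps M q p k k1" "state k1 = s + 2" "rep e k1"
    using test_correct[OF sub(1) While_loop.prems(2,3)] While_loop.hyps(1) by auto
  obtain k2 where k2: "steps M q p k1 k2" "state k2 = s + 2 + len c" "rep e' k2"
    using While_loop.IH(1)[OF sub(2) k1(2,3)] by auto
  have "state k2 = s + len c + 2" using k2(2) by simp
  from goto_correct[OF sub(3) this k2(3)]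
  obtain k3 where k3: "steps M q p k2 k3" "state k3 = s" "rep e' k3"
    by auto
  obtain k4 where k4: "steps M q p k3 k4" "state k4 = s + len (While t c)" "rep e'' k4"
    using While_loop.IH(2)[OF While_loop.prems(1) k3(2,3)] by blast
  have "steps M q p k k4"
    by (rule rtranclp_trans[OF k1(1) rtranclp_trans[OF k2(1) rtranclp_trans[OF k3(1) k4(1)]]])
  then show ?case
    using k4(2,3) by blast
qed

end

text \<open>Both runs follow the same partial function until it is undefined.\<close>

lemma steps_final_unique:
  assumes "steps M q p k c" "step M q p c = None" "steps M q p k c'" "step M q p c' = None"
  shows "c = c'"
  using assms(1,3)
proof (induction rule: converse_rtranclp_induct)
  case base
  then show ?case
    by (cases rule: converse_rtranclpE) (use assms(2) in auto)
next
  case (step y z)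
  from step.prems show ?case
    by (cases rule: converse_rtranclpE) (use step assms(4) in auto)
qed

lemma halts_with_unique: "halts_with M q p k v \<Longrightarrow> halts_with M q p k w \<Longrightarrow> v = w"
  unfolding halts_with_def using steps_final_unique by blast

lemma machine_fun_eqI:
  assumes "\<And>k. halts_with (machine n) q p k (f k)"
  shows "machine_fun n q p = Some f"
proof -
  have "(THE v. halts_with (machine n) q p k v) = f k" for k
    using assms halts_with_unique by blast
  then show ?thesis
    using assms unfolding machine_fun_def by auto
qed

lemma machine_fun_SomeD:
  assumes "machine_fun n q p = Some f"
  shows "halts_with (machine n) q p k (f k)"
  using assms halts_with_unique unfolding machine_fun_def
  by (metis (mono_tags, lifting) option.distinct(1) option.inject theI)

lemma halts_with_compile:
  assumes "exec q p c ((\<lambda>_. 0)(0 := k)) e"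
  shows "halts_with (compile 0 c) q p k (e 0)"
proof -
  have "rep ((\<lambda>_. 0)(0 := k)) (init k)"
    by (auto simp: rep_def init_def unary_def)
  then obtain k' where k': "steps (compile 0 c) q p (init k) k'" "state k' = len c" "rep e k'"
    using compile_correct[OF deterministic_compile assms subset_refl, of "init k"]
    by (auto simp: init_def)
  \<comment> \<open>The exit state \<open>len c\<close> lies beyond all states of the code, so no
    entry applies there.\<close>
  have "find (\<lambda>(s, t, a, act, s'). s = state k' \<and> a = tape k' t (head k' t)) (compile 0 c) = None"
    using k'(2) by (auto simp: find_None_iff dest!: compile_states)
  then have "step (compile 0 c) q p k' = None"
    unfolding step_def by simp
  then show ?thesis
    unfolding halts_with_def using k' by (auto simp: rep_def)
qed


section \<open>Primitive recursion relative to an oracle and an input\<close>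

text \<open>\<open>E i\<close> describes the registers after \<open>i\<close> rounds and
  \<open>n\<close> is the number of rounds. The proof is by induction on the number of remaining
  rounds.\<close>

lemma exec_While:
  assumes "e = E 0" "e' = E n" "E n t = 0"
    and "\<And>i. i < n \<Longrightarrow> E i t \<noteq> 0 \<and> exec q p c (E i) (E (Suc i))"
  shows "exec q p (While t c) e e'"
proof -
  have "exec q p (While t c) (E (n - i)) (E n)" if "i \<le> n" for i
    using that
  proof (induction i)
    case 0
    then show ?case using assms(3) by (simp add: exec.While_done)
  next
    case (Suc i)
    then have "n - Suc i < n" "Suc (n - Suc i) = n - i" by auto
    then show ?case
      using assms(4)[of "n - Suc i"] Suc by (auto intro: exec.While_loop)
  qed
  from this[of n] show ?thesis using assms(1,2) by simp
qed

lemma exec_eq: "exec q p c e e1 \<Longrightarrow> e1 = e2 \<Longrightarrow> exec q p c e e2"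
  by simp

section \<open>Register programs for moving, copying and pairing\<close>

definition clear :: "nat \<Rightarrow> com" where
  "clear a = While a (Dec a)"

definition move :: "nat \<Rightarrow> nat \<Rightarrow> com" where
  "move a b = While a (Dec a ;; Inc b)"

text \<open>Reading a register by a loop empties it; \<open>t\<close> keeps a second copy from which
  \<open>a\<close> is restored.\<close>

definition copy :: "nat \<Rightarrow> nat \<Rightarrow> nat \<Rightarrow> com" where
  "copy a b t = While a (Dec a ;; Inc b ;; Inc t) ;; move t a"

lemma exec_clear: "exec q p (clear a) e (e(a := 0))"
  unfolding clear_def
  by (rule exec_While[where n = "e a" and E = "\<lambda>i. e(a := e a - i)"])
    (auto intro!: exec_eq[OF exec.Dec])

lemma exec_move: "a \<noteq> b \<Longrightarrow> exec q p (move a b) e (e(a := 0, b := e b + e a))"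
  unfolding move_def
  by (rule exec_While[where n = "e a" and E = "\<lambda>i. e(a := e a - i, b := e b + i)"])
    (auto intro!: exec_eq[OF exec.Seq[OF exec.Dec exec.Inc]])

lemma exec_copy:
  assumes "a \<noteq> b" "a \<noteq> t" "b \<noteq> t" "e t = 0"
  shows "exec q p (copy a b t) e (e(b := e b + e a))"
proof -
  let ?e = "e(a := 0, b := e b + e a, t := e a)"
  have "exec q p (While a (Dec a ;; Inc b ;; Inc t)) e ?e"
    by (rule exec_While[where n = "e a" and E = "\<lambda>i. e(a := e a - i, b := e b + i, t := i)"])
      (use assms in \<open>auto intro!: exec_eq[OF exec.Seq[OF exec.Dec exec.Seq[OF exec.Inc exec.Inc]]]\<close>)
  moreover have "exec q p (move t a) ?e (e(b := e b + e a))"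
    by (rule exec_eq[OF exec_move]) (use assms in auto)
  ultimately show ?thesis
    unfolding copy_def by (rule exec.Seq)
qed

text \<open>Uses \<open>prod_encode (m, n) = triangle (m + n) + m\<close> with \<open>m\<close> in
  register \<open>b + 2\<close> and \<open>n\<close> in \<open>b + 1\<close>. The loop sums the
  triangular number from its largest summand downwards.\<close>

definition encode :: "nat \<Rightarrow> com" where
  "encode b = copy (b + 2) b (b + 3) ;; move (b + 2) (b + 1) ;;
     While (b + 1) (copy (b + 1) b (b + 2) ;; Dec (b + 1))"

lemma mono_triangle: "mono triangle"
  by (rule mono_iff_le_Suc[THEN iffD2]) simp

lemma exec_encode:
  assumes "e b = 0" "\<And>r. r > b + 2 \<Longrightarrow> e r = 0"
  shows "exec q p (encode b) e (e(b := prod_encode (e (b + 2), e (b + 1)), b + 1 := 0, b + 2 := 0))"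
proof -
  let ?m = "e (b + 2)" and ?s = "e (b + 2) + e (b + 1)"
  \<comment> \<open>After \<open>i\<close> rounds the \<open>i\<close> largest summands of the
    triangular number have been added, whence the difference.\<close>
  let ?E = "\<lambda>i. e(b := ?m + (triangle ?s - triangle (?s - i)), b + 1 := ?s - i, b + 2 := 0)"
  have "exec q p (copy (b + 2) b (b + 3)) e (e(b := ?m))"
    by (rule exec_eq[OF exec_copy]) (use assms in auto)
  moreover have "exec q p (move (b + 2) (b + 1)) (e(b := ?m)) (?E 0)"
    by (rule exec_eq[OF exec_move]) auto
  moreover have "exec q p (While (b + 1) (copy (b + 1) b (b + 2) ;; Dec (b + 1))) (?E 0)
      (e(b := prod_encode (e (b + 2), e (b + 1)), b + 1 := 0, b + 2 := 0))"
  proof (rule exec_While[where n = ?s and E = ?E], goal_cases)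
    case (4 i)
    have *: "?s - i = Suc (?s - Suc i)" using 4 by simp
    have "triangle (?s - i) \<le> triangle ?s"
      by (rule monoD[OF mono_triangle]) simp
    then have "triangle ?s - triangle (?s - Suc i) = triangle ?s - triangle (?s - i) + (?s - i)"
      unfolding * triangle_Suc by simp
    then have "exec q p (copy (b + 1) b (b + 2)) (?E i) ((?E i)(b := ?m + (triangle ?s - triangle (?s - Suc i))))"
      by (intro exec_eq[OF exec_copy]) auto
    then have "exec q p (copy (b + 1) b (b + 2) ;; Dec (b + 1)) (?E i) (?E (Suc i))"
      by (rule exec_eq[OF exec.Seq[OF _ exec.Dec]]) auto
    then show ?case using 4 by simp
  qed (auto simp: prod_encode_def fun_eq_iff)
  ultimately show ?thesis
    unfolding encode_def by (intro exec.Seq)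
qed

lemma prod_decode_0 [simp]: "prod_decode 0 = (0, 0)"
  by (simp add: prod_decode_def prod_decode_aux.simps)

text \<open>The pairing runs through antidiagonals: the first component grows while the second
  falls, and \<open>(a, 0)\<close> is followed by the start \<open>(0, Suc a)\<close> of the next
  one.\<close>

lemma prod_decode_Suc:
  "prod_decode (Suc n) = (case prod_decode n of (a, b) \<Rightarrow>
     if b = 0 then (0, Suc a) else (Suc a, b - 1))"
proof -
  obtain a b where ab: "prod_decode n = (a, b)" by fastforce
  then have n: "n = prod_encode (a, b)" by (metis prod_decode_inverse)
  have "Suc n = prod_encode (if b = 0 then (0, Suc a) else (Suc a, b - 1))"
    unfolding n by (cases b) (auto simp: prod_encode_def)
  then show ?thesis using ab by (simp add: prod_encode_inverse)
qed

text \<open>Walks through the enumeration of pairs from \<open>(0, 0)\<close>, one step as in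
  \<open>prod_decode_Suc\<close> for each decrement of \<open>b\<close>.\<close>

definition decode :: "nat \<Rightarrow> com" where
  "decode b = While b (Dec b ;;
     Cond (b + 2) (Dec (b + 2) ;; Inc (b + 1)) (move (b + 1) (b + 2) ;; Inc (b + 2)))"

lemma exec_decode:
  assumes "\<And>r. r > b \<Longrightarrow> e r = 0"
  shows "exec q p (decode b) e
    (e(b := 0, b + 1 := fst (prod_decode (e b)), b + 2 := snd (prod_decode (e b))))"
  unfolding decode_def
proof (rule exec_While[where n = "e b" and
      E = "\<lambda>i. e(b := e b - i, b + 1 := fst (prod_decode i), b + 2 := snd (prod_decode i))"],
    goal_cases)
  case 1
  then show ?case using assms by (auto simp: fun_eq_iff)
next
  case (4 i)
  obtain x y where xy: "prod_decode i = (x, y)" by fastforce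
  let ?e = "e(b := e b - Suc i, b + 1 := x, b + 2 := y)"
  let ?e' = "e(b := e b - Suc i, b + 1 := fst (prod_decode (Suc i)), b + 2 := snd (prod_decode (Suc i)))"
  have "exec q p (Cond (b + 2) (Dec (b + 2) ;; Inc (b + 1)) (move (b + 1) (b + 2) ;; Inc (b + 2))) ?e ?e'"
  proof (cases "y = 0")
    case True
    then show ?thesis
      by (intro exec.Cond_zero exec_eq[OF exec.Seq[OF exec_move exec.Inc]])
        (auto simp: prod_decode_Suc xy)
  next
    case False
    then show ?thesis
      by (intro exec.Cond_nonzero exec_eq[OF exec.Seq[OF exec.Dec exec.Inc]])
        (auto simp: prod_decode_Suc xy)
  qed
  moreover have "exec q p (Dec b) (e(b := e b - i, b + 1 := x, b + 2 := y)) ?e"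
    by (rule exec_eq[OF exec.Dec]) (auto simp: fun_eq_iff)
  ultimately show ?case
    using 4 xy exec.Seq by simp
qed auto

text \<open>
  The code may depend on the base register \<open>b\<close>, but on neither the oracle nor the input; registers above
  \<open>b\<close> serve as scratch space.
\<close>

definition prog :: "(baire \<Rightarrow> baire \<Rightarrow> nat \<Rightarrow> nat) \<Rightarrow> bool" where
  "prog f \<longleftrightarrow> (\<forall>b. \<exists>c. \<forall>q p e. (\<forall>r>b. e r = 0) \<longrightarrow> exec q p c e (e(b := f q p (e b))))"

section \<open>Basic closure properties of computed functions\<close>

lemma progI:
  assumes "\<And>b q p e. (\<And>r. r > b \<Longrightarrow> e r = 0) \<Longrightarrow> exec q p (c b) e (e(b := f q p (e b)))"
  shows "prog f"
  unfolding prog_def using assms by blast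

lemma progE:
  assumes "prog f"
  obtains c where "\<And>b q p e. (\<And>r. r > b \<Longrightarrow> e r = 0) \<Longrightarrow> exec q p (c b) e (e(b := f q p (e b)))"
  using assms unfolding prog_def by metis

lemma prog_id: "prog (\<lambda>q p x. x)"
  by (rule progI[of "\<lambda>b. Skip"]) (auto intro: exec_eq[OF exec.Skip])

lemma prog_zero: "prog (\<lambda>q p x. 0)"
  by (rule progI[of clear]) (auto intro: exec_clear)

lemma prog_Suc_id: "prog (\<lambda>q p x. Suc x)"
  by (rule progI[of Inc]) (auto intro: exec.Inc)

lemma prog_oracle_id: "prog (\<lambda>q p x. q x)"
  by (rule progI[of Ask_oracle]) (auto intro: exec.Ask_oracle)

lemma prog_input_id: "prog (\<lambda>q p x. p x)"
  by (rule progI[of Ask_input]) (auto intro: exec.Ask_input)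

lemma prog_comp:
  assumes "prog f" "prog g"
  shows "prog (\<lambda>q p x. f q p (g q p x))"
proof -
  obtain c where c: "\<And>b q p e. (\<And>r. r > b \<Longrightarrow> e r = 0) \<Longrightarrow> exec q p (c b) e (e(b := f q p (e b)))"
    using progE[OF assms(1)] by blast
  obtain d where d: "\<And>b q p e. (\<And>r. r > b \<Longrightarrow> e r = 0) \<Longrightarrow> exec q p (d b) e (e(b := g q p (e b)))"
    using progE[OF assms(2)] by blast
  show ?thesis
    by (rule progI[of "\<lambda>b. d b ;; c b"]) (rule exec_eq[OF exec.Seq[OF d c]], auto)
qed

lemma prog_fst_id: "prog (\<lambda>q p x. fst (prod_decode x))"
  by (rule progI[of "\<lambda>b. decode b ;; move (b + 1) b ;; clear (b + 2)"])
    (rule exec_eq[OF exec.Seq[OF exec_decode exec.Seq[OF exec_move exec_clear]]], auto simp: fun_eq_iff)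

lemma prog_snd_id: "prog (\<lambda>q p x. snd (prod_decode x))"
  by (rule progI[of "\<lambda>b. decode b ;; move (b + 2) b ;; clear (b + 1)"])
    (rule exec_eq[OF exec.Seq[OF exec_decode exec.Seq[OF exec_move exec_clear]]], auto simp: fun_eq_iff)

lemma prog_pair:
  assumes "prog f" "prog g"
  shows "prog (\<lambda>q p x. prod_encode (f q p x, g q p x))"
proof -
  obtain c where c: "\<And>b q p e. (\<And>r. r > b \<Longrightarrow> e r = 0) \<Longrightarrow> exec q p (c b) e (e(b := f q p (e b)))"
    using progE[OF assms(1)] by blast
  obtain d where d: "\<And>b q p e. (\<And>r. r > b \<Longrightarrow> e r = 0) \<Longrightarrow> exec q p (d b) e (e(b := g q p (e b)))"
    using progE[OF assms(2)] by blast
  \<comment> \<open>A program needs all registers above its base to be zero. So \<open>g\<close> is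
    evaluated above the saved argument, and then the argument is moved above the value of
    \<open>g\<close> before \<open>f\<close> is evaluated. This leaves the components where
    \<open>encode\<close> expects them.\<close>
  show ?thesis
  proof (rule progI[of "\<lambda>b. copy b (b + 1) (b + 2) ;; d (b + 1) ;; move b (b + 2) ;; c (b + 2) ;; encode b"])
    fix b q p and e :: "nat \<Rightarrow> nat"
    assume e: "\<And>r. r > b \<Longrightarrow> e r = 0"
    show "exec q p (copy b (b + 1) (b + 2) ;; d (b + 1) ;; move b (b + 2) ;; c (b + 2) ;; encode b)
        e (e(b := prod_encode (f q p (e b), g q p (e b))))"
      by (rule exec_eq[OF exec.Seq[OF exec_copy exec.Seq[OF d exec.Seq[OF exec_move
                exec.Seq[OF c exec_encode]]]]]) (auto simp: e fun_eq_iff)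
  qed
qed

lemma prog_iter_id:
  assumes "prog f"
  shows "prog (\<lambda>q p x. (f q p ^^ fst (prod_decode x)) (snd (prod_decode x)))"
proof -
  obtain c where c: "\<And>b q p e. (\<And>r. r > b \<Longrightarrow> e r = 0) \<Longrightarrow> exec q p (c b) e (e(b := f q p (e b)))"
    using progE[OF assms(1)] by blast
  \<comment> \<open>The counter \<open>b + 1\<close> lies below the base \<open>b + 2\<close> of the
    loop body, which therefore preserves it.\<close>
  have loop: "exec q p (While (b + 1) (Dec (b + 1) ;; c (b + 2))) e
      (e(b + 1 := 0, b + 2 := (f q p ^^ e (b + 1)) (e (b + 2))))"
    if e: "\<And>r. r > b + 2 \<Longrightarrow> e r = 0" for b q p e
  proof (rule exec_While[where n = "e (b + 1)" and
        E = "\<lambda>i. e(b + 1 := e (b + 1) - i, b + 2 := (f q p ^^ i) (e (b + 2)))"], goal_cases)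
    case (4 i)
    have "exec q p (Dec (b + 1) ;; c (b + 2))
       (e(b + 1 := e (b + 1) - i, b + 2 := (f q p ^^ i) (e (b + 2))))
       (e(b + 1 := e (b + 1) - Suc i, b + 2 := (f q p ^^ Suc i) (e (b + 2))))"
      by (rule exec_eq[OF exec.Seq[OF exec.Dec c]]) (auto simp: e)
    then show ?case using 4 by simp
  qed auto
  show ?thesis
  proof (rule progI[of "\<lambda>b. decode b ;; While (b + 1) (Dec (b + 1) ;; c (b + 2)) ;; move (b + 2) b"])
    fix b q p and e :: "nat \<Rightarrow> nat"
    assume e: "\<And>r. r > b \<Longrightarrow> e r = 0"
    show "exec q p (decode b ;; While (b + 1) (Dec (b + 1) ;; c (b + 2)) ;; move (b + 2) b) e
        (e(b := (f q p ^^ fst (prod_decode (e b))) (snd (prod_decode (e b)))))"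
      by (rule exec_eq[OF exec.Seq[OF exec_decode exec.Seq[OF loop exec_move]]])
        (auto simp: e fun_eq_iff)
  qed
qed

text \<open>The code depends on neither sequence, so one machine serves all of them; its number
  exists because the numbering is onto. Base \<open>0\<close> matches \<open>init\<close>, where all
  other tapes are blank.\<close>

lemma prog_machine:
  assumes "prog f"
  shows "\<exists>n. \<forall>q p. machine_fun n q p = Some (f q p)"
proof -
  obtain c where c: "\<And>b q p e. (\<And>r. r > b \<Longrightarrow> e r = 0) \<Longrightarrow> exec q p (c b) e (e(b := f q p (e b)))"
    using progE[OF assms(1)] by blast
  obtain n where n: "machine n = compile 0 (c 0)"
    using bij_machine by (metis bij_pointE)
  have "halts_with (machine n) q p k (f q p k)" for q p k
    using halts_with_compile[OF c[of 0 "(\<lambda>_. 0)(0 := k)" q p]] by (simp add: n)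
  then show ?thesis
    using machine_fun_eqI by blast
qed


section \<open>Recursion and arithmetic with parameters\<close>

abbreviation fstd :: "nat \<Rightarrow> nat" where "fstd x \<equiv> fst (prod_decode x)"
abbreviation sndd :: "nat \<Rightarrow> nat" where "sndd x \<equiv> snd (prod_decode x)"

lemmas prog_fst = prog_comp[OF prog_fst_id]
lemmas prog_snd = prog_comp[OF prog_snd_id]
lemmas prog_Suc = prog_comp[OF prog_Suc_id]
lemmas prog_oracle = prog_comp[OF prog_oracle_id]
lemmas prog_input = prog_comp[OF prog_input_id]

lemma prog_const: "prog (\<lambda>q p x. c)"
  by (induction c) (auto intro: prog_zero prog_Suc)

text \<open>Functions of several arguments count as computed if their versions on coded pairs are;
  the assumptions of the rules below have this form.\<close>

lemma prog_app2:
  assumes "prog (\<lambda>q p z. f q p (fstd z) (sndd z))" "prog a" "prog b"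
  shows "prog (\<lambda>q p x. f q p (a q p x) (b q p x))"
  using prog_comp[OF assms(1) prog_pair[OF assms(2,3)]] by simp

text \<open>\<open>prog_iter_id\<close> iterates a function of the state alone, so the parameter
  \<open>x\<close> is carried along as part of the state.\<close>

lemma prog_iter:
  assumes "prog n" "prog a" "prog (\<lambda>q p z. g q p (fstd z) (sndd z))"
  shows "prog (\<lambda>q p x. (g q p x ^^ n q p x) (a q p x))"
proof -
  let ?F = "\<lambda>q p z. prod_encode (fstd z, g q p (fstd z) (sndd z))"
  have "prog ?F"
    by (intro prog_pair prog_fst prog_id assms)
  from prog_comp[OF prog_iter_id[OF this] prog_pair[OF assms(1) prog_pair[OF prog_id assms(2)]]]
  have "prog (\<lambda>q p x. (?F q p ^^ n q p x) (prod_encode (x, a q p x)))"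
    by simp
  moreover have "(?F q p ^^ m) (prod_encode (x, y)) = prod_encode (x, (g q p x ^^ m) y)" for q p m x y
    by (induction m) auto
  ultimately show ?thesis
    using prog_snd by fastforce
qed

text \<open>Recursion is iteration on pairs of a counter and the value reached so far.\<close>

lemma prog_rec:
  assumes "prog n" "prog a" "prog (\<lambda>q p z. g q p (fstd z) (fstd (sndd z)) (sndd (sndd z)))"
  shows "prog (\<lambda>q p x. rec_nat (a q p x) (g q p x) (n q p x))"
proof -
  let ?G = "\<lambda>q p x y. prod_encode (Suc (fstd y), g q p x (fstd y) (sndd y))"
  have "prog (\<lambda>q p x. sndd ((?G q p x ^^ n q p x) (prod_encode (0, a q p x))))"
    by (intro prog_iter prog_snd prog_pair prog_const prog_Suc prog_fst prog_id assms)
  moreover have "(?G q p x ^^ m) (prod_encode (0, y)) = prod_encode (m, rec_nat y (g q p x) m)"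
    for q p x m y
    by (induction m) auto
  ultimately show ?thesis by simp
qed

lemma prog_add:
  assumes "prog a" "prog b"
  shows "prog (\<lambda>q p x. a q p x + b q p x)"
proof -
  have "prog (\<lambda>q p x. (Suc ^^ b q p x) (a q p x))"
    by (intro prog_iter prog_Suc prog_snd prog_id assms)
  moreover have "(Suc ^^ n) m = m + n" for n m by (induction n) auto
  ultimately show ?thesis by (simp only:)
qed

lemma prog_diff:
  assumes "prog a" "prog b"
  shows "prog (\<lambda>q p x. a q p x - b q p x)"
proof -
  have "prog (\<lambda>q p x. rec_nat 0 (\<lambda>i y. i) x)"
    by (intro prog_rec prog_snd prog_fst prog_const prog_id)
  moreover have "rec_nat 0 (\<lambda>i y. i) n = n - 1" for n by (cases n) auto
  ultimately have *: "prog (\<lambda>q p x. x - 1)" by simp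
  have "prog (\<lambda>q p x. ((\<lambda>y. y - 1) ^^ b q p x) (a q p x))"
    by (intro prog_iter prog_comp[OF *] prog_snd prog_id assms)
  moreover have "((\<lambda>y. y - 1) ^^ n) m = m - n" for n m :: nat by (induction n) auto
  ultimately show ?thesis by simp
qed

section \<open>Predicates and bounded quantifiers\<close>

definition prog_pred :: "(baire \<Rightarrow> baire \<Rightarrow> nat \<Rightarrow> bool) \<Rightarrow> bool" where
  "prog_pred P \<longleftrightarrow> prog (\<lambda>q p x. if P q p x then 1 else 0)"

text \<open>A case distinction iterates the constant function with value \<open>a\<close> once or
  not at all, starting from \<open>b\<close>.\<close>

lemma prog_if:
  assumes "prog_pred P" "prog a" "prog b"
  shows "prog (\<lambda>q p x. if P q p x then a q p x else b q p x)"
proof -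
  have "prog (\<lambda>q p x. ((\<lambda>y. a q p x) ^^ (if P q p x then 1 else 0)) (b q p x))"
    using assms(1) unfolding prog_pred_def
    by (intro prog_iter assms(2,3) prog_comp[OF assms(2)] prog_fst prog_id)
  moreover have "((\<lambda>y. a q p x) ^^ (if P q p x then 1 else 0)) (b q p x) =
      (if P q p x then a q p x else b q p x)" for q p x
    by simp
  ultimately show ?thesis by simp
qed

lemma prog_pred_eq_zero:
  assumes "prog a"
  shows "prog_pred (\<lambda>q p x. a q p x = 0)"
proof -
  have "prog (\<lambda>q p x. 1 - a q p x)"
    by (intro prog_diff prog_const assms)
  moreover have "1 - n = (if n = 0 then 1 else 0)" for n :: nat by auto
  ultimately show ?thesis by (simp add: prog_pred_def)
qed

lemma prog_pred_app:
  assumes "prog_pred P" "prog a"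
  shows "prog_pred (\<lambda>q p x. P q p (a q p x))"
  using prog_comp[OF assms(1)[unfolded prog_pred_def] assms(2)] by (simp add: prog_pred_def)

lemma prog_pred_not:
  assumes "prog_pred P"
  shows "prog_pred (\<lambda>q p x. \<not> P q p x)"
proof -
  have "prog (\<lambda>q p x. if P q p x then 0 else 1)"
    by (intro prog_if prog_const assms)
  moreover have "(if P q p x then 0 else 1) = (if \<not> P q p x then 1 else 0 :: nat)" for q p x
    by simp
  ultimately show ?thesis by (simp add: prog_pred_def)
qed

lemma prog_pred_conj:
  assumes "prog_pred P" "prog_pred Q"
  shows "prog_pred (\<lambda>q p x. P q p x \<and> Q q p x)"
proof -
  have "prog (\<lambda>q p x. if P q p x then (if Q q p x then 1 else 0) else 0)"
    by (intro prog_if prog_const assms)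
  moreover have "(if P q p x then (if Q q p x then 1 else 0) else 0) =
      (if P q p x \<and> Q q p x then 1 else 0 :: nat)" for q p x
    by simp
  ultimately show ?thesis by (simp add: prog_pred_def)
qed

lemma prog_pred_le: "prog a \<Longrightarrow> prog b \<Longrightarrow> prog_pred (\<lambda>q p x. a q p x \<le> b q p x)"
  using prog_pred_eq_zero[OF prog_diff, of a b] by simp

lemma prog_pred_eq:
  assumes "prog a" "prog b"
  shows "prog_pred (\<lambda>q p x. a q p x = b q p x)"
  using prog_pred_conj[OF prog_pred_le[OF assms] prog_pred_le[OF assms(2,1)]] by (simp add: eq_iff)

lemma prog_pred_less: "prog a \<Longrightarrow> prog b \<Longrightarrow> prog_pred (\<lambda>q p x. a q p x < b q p x)"
  using prog_pred_not[OF prog_pred_le, of b a] by (simp add: not_le)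

lemma prog_pred_bex:
  assumes "prog n" "prog_pred (\<lambda>q p z. P q p (fstd z) (sndd z))"
  shows "prog_pred (\<lambda>q p x. \<exists>k<n q p x. P q p x k)"
proof -
  have "prog_pred (\<lambda>q p z. P q p (fstd z) (fstd (sndd z)))"
    using prog_pred_app[OF assms(2) prog_pair[OF prog_fst[OF prog_id] prog_fst[OF prog_snd[OF prog_id]]]] by simp
  then have "prog (\<lambda>q p x. rec_nat 0 (\<lambda>k y. if P q p x k then 1 else y) (n q p x))"
    by (intro prog_rec prog_if prog_const prog_snd prog_id assms)
  moreover have "rec_nat 0 (\<lambda>k y. if P q p x k then 1 else y) m =
      (if \<exists>k<m. P q p x k then 1 else 0 :: nat)" for q p x m
    by (induction m) (auto simp: less_Suc_eq)
  ultimately show ?thesis by (simp add: prog_pred_def)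
qed

section \<open>Coded lists\<close>

lemma length_list_decode: "length (list_decode n) \<le> n"
proof (induction n rule: list_decode.induct)
  case (2 n)
  obtain x y where xy: "prod_decode n = (x, y)" by fastforce
  then have "y \<le> n" by (metis le_prod_encode_2 prod_decode_inverse)
  then show ?case using 2[OF xy[symmetric]] xy by simp
qed simp

text \<open>The state pairs the code of the remaining list with the accumulator. By
  \<open>length_list_decode\<close> the code itself is a sufficient number of rounds, and rounds
  after the end of the list change nothing.\<close>

lemma prog_foldl:
  assumes "prog l" "prog a" "prog (\<lambda>q p z. g q p (fstd z) (fstd (sndd z)) (sndd (sndd z)))"
  shows "prog (\<lambda>q p x. foldl (g q p x) (a q p x) (list_decode (l q p x)))"
proof -
  let ?G = "\<lambda>q p x y. if fstd y = 0 then y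
     else prod_encode (sndd (fstd y - 1), g q p x (sndd y) (fstd (fstd y - 1)))"
  have g: "prog (\<lambda>q p x. g q p (f q p x) (b q p x) (c q p x))" if "prog f" "prog b" "prog c" for f b c
    using prog_comp[OF assms(3) prog_pair[OF that(1) prog_pair[OF that(2,3)]]] by simp
  have "prog (\<lambda>q p x. sndd ((?G q p x ^^ l q p x) (prod_encode (l q p x, a q p x))))"
    by (intro prog_iter prog_snd prog_pair prog_const prog_if prog_pred_eq_zero prog_diff prog_fst prog_id g assms)
  moreover have "(?G q p x ^^ m) (prod_encode (n, y)) = prod_encode (0, foldl (g q p x) y (list_decode n))"
    if "length (list_decode n) \<le> m" for q p x m n y
    using that
  proof (induction m arbitrary: n y)
    case 0
    then have "n = 0" by (cases n) (auto split: prod.splits)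
    then show ?case by simp
  next
    case (Suc m)
    show ?case
    proof (cases n)
      case 0
      have "(?G q p x ^^ k) (prod_encode (0, y)) = prod_encode (0, y)" for k
        by (induction k) auto
      from this[of "Suc m"] show ?thesis using 0 by simp
    next
      case (Suc n')
      have "(?G q p x ^^ Suc m) (prod_encode (n, y)) = (?G q p x ^^ m) (?G q p x (prod_encode (n, y)))"
        by (simp only: funpow_Suc_right o_apply)
      also have "?G q p x (prod_encode (n, y)) = prod_encode (sndd n', g q p x y (fstd n'))"
        using Suc by simp
      also have "(?G q p x ^^ m) \<dots> =
          prod_encode (0, foldl (g q p x) (g q p x y (fstd n')) (list_decode (sndd n')))"
        by (rule Suc.IH) (use Suc.prems Suc in \<open>auto split: prod.splits\<close>)
      finally show ?thesis
        using Suc by (auto split: prod.splits)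
    qed
  qed
  ultimately show ?thesis
    by (simp add: length_list_decode)
qed

lemma prog_pred_list_all:
  assumes "prog l" "prog_pred (\<lambda>q p z. P q p (fstd z) (sndd z))"
  shows "prog_pred (\<lambda>q p x. \<forall>y\<in>set (list_decode (l q p x)). P q p x y)"
proof -
  have "prog_pred (\<lambda>q p z. P q p (fstd z) (sndd (sndd z)))"
    using prog_pred_app[OF assms(2) prog_pair[OF prog_fst[OF prog_id] prog_snd[OF prog_snd[OF prog_id]]]] by simp
  then have "prog (\<lambda>q p x. foldl (\<lambda>b y. if P q p x y then b else 0) 1 (list_decode (l q p x)))"
    by (intro prog_foldl prog_if prog_const prog_fst prog_snd prog_id assms)
  moreover have "foldl (\<lambda>b y. if P q p x y then b else 0) 0 ys = (0 :: nat)" for q p x ys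
    by (induction ys) auto
  then have "foldl (\<lambda>b y. if P q p x y then b else 0) 1 ys =
      (if \<forall>y\<in>set ys. P q p x y then 1 else 0 :: nat)" for q p x ys
    by (induction ys) auto
  ultimately show ?thesis by (simp add: prog_pred_def)
qed

definition find_code :: "(nat \<Rightarrow> bool) \<Rightarrow> nat \<Rightarrow> nat" where
  "find_code P l = (case find P (list_decode l) of None \<Rightarrow> 0 | Some y \<Rightarrow> Suc y)"

lemma prog_find_code:
  assumes "prog l" "prog_pred (\<lambda>q p z. P q p (fstd z) (sndd z))"
  shows "prog (\<lambda>q p x. find_code (P q p x) (l q p x))"
proof -
  have "prog_pred (\<lambda>q p z. P q p (fstd z) (sndd (sndd z)))"
    using prog_pred_app[OF assms(2) prog_pair[OF prog_fst[OF prog_id] prog_snd[OF prog_snd[OF prog_id]]]] by simp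
  then have "prog (\<lambda>q p x. foldl (\<lambda>b y. if b = 0 \<and> P q p x y then Suc y else b) 0 (list_decode (l q p x)))"
    by (intro prog_foldl prog_if prog_const prog_fst prog_snd prog_id assms prog_pred_conj prog_pred_eq_zero prog_Suc)
  moreover have "foldl (\<lambda>b y. if b = 0 \<and> P q p x y then Suc y else b) (Suc n) ys = Suc n" for q p x ys n
    by (induction ys) auto
  then have "foldl (\<lambda>b y. if b = 0 \<and> P q p x y then Suc y else b) 0 ys =
      (case find (P q p x) ys of None \<Rightarrow> 0 | Some y \<Rightarrow> Suc y)" for q p x ys
    by (induction ys) auto
  ultimately show ?thesis by (simp add: find_code_def)
qed


section \<open>Simulation of machines\<close>

text \<open>The default value is \<open>0\<close>, because \<open>prod_decode 0 = (0, 0)\<close>.\<close>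

definition lookup :: "nat \<Rightarrow> nat \<Rightarrow> nat" where
  "lookup l k = sndd (find_code (\<lambda>y. fstd y = k) l - 1)"

text \<open>A list code with a new head: the new pair shadows older pairs with the same key.\<close>

definition insert_code :: "nat \<Rightarrow> nat \<Rightarrow> nat \<Rightarrow> nat" where
  "insert_code l k v = Suc (prod_encode (prod_encode (k, v), l))"

lemma lookup_0 [simp]: "lookup 0 k = 0"
  by (simp add: lookup_def find_code_def)

lemma lookup_insert [simp]: "lookup (insert_code l k v) j = (if j = k then v else lookup l j)"
  by (auto simp: lookup_def insert_code_def find_code_def)

lemma prog_lookup:
  assumes "prog a" "prog b"
  shows "prog (\<lambda>q p x. lookup (a q p x) (b q p x))"
  unfolding lookup_def
  by (intro prog_snd prog_diff prog_find_code prog_pred_eq prog_fst prog_const prog_id assms prog_comp[OF assms(2)])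

lemma prog_insert: "prog a \<Longrightarrow> prog b \<Longrightarrow> prog c \<Longrightarrow> prog (\<lambda>q p x. insert_code (a q p x) (b q p x) (c q p x))"
  unfolding insert_code_def by (intro prog_Suc prog_pair)

definition unary_code :: "nat \<Rightarrow> nat" where
  "unary_code n = rec_nat 0 (\<lambda>i l. insert_code l i 1) n"

lemma lookup_unary_code [simp]: "lookup (unary_code n) = unary n"
proof (induction n)
  case (Suc n)
  then show ?case
    unfolding unary_code_def by (auto simp: fun_eq_iff unary_def)
qed (auto simp: unary_code_def unary_def)

lemma prog_unary_code: "prog a \<Longrightarrow> prog (\<lambda>q p x. unary_code (a q p x))"
  unfolding unary_code_def
  by (intro prog_rec prog_insert prog_snd prog_fst prog_id prog_const)

definition value_code :: "nat \<Rightarrow> nat" where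
  "value_code l = rec_nat 0 (\<lambda>i y. if lookup l y = 1 then Suc y else y) l"

lemma support_lookup: "{k. lookup l k \<noteq> 0} \<subseteq> fstd ` set (list_decode l)"
proof
  fix k
  assume "k \<in> {k. lookup l k \<noteq> 0}"
  then have "find (\<lambda>y. fstd y = k) (list_decode l) \<noteq> None"
    by (auto simp: lookup_def find_code_def split: option.splits)
  then show "k \<in> fstd ` set (list_decode l)"
    by (auto simp: find_None_iff)
qed

text \<open>A table with code \<open>l\<close> has at most \<open>l\<close> keys with nonzero
  values, so the \<open>l + 1\<close> cells up to \<open>l\<close> cannot all contain 1. Hence a
  search of \<open>l\<close> rounds finds the least cell without 1.\<close>

lemma value_code [simp]: "value_code l = unary_value (lookup l)"
proof -
  let ?r = "rec_nat 0 (\<lambda>i y. if lookup l y = 1 then Suc y else y)"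
  have inv: "(\<forall>i<?r n. lookup l i = 1) \<and> (?r n = n \<or> lookup l (?r n) \<noteq> 1)" for n
    by (induction n) (auto simp: less_Suc_eq)
  have "lookup l (?r l) \<noteq> 1"
  proof
    assume *: "lookup l (?r l) = 1"
    then have "?r l = l" using inv by blast
    then have "{..l} \<subseteq> {k. lookup l k \<noteq> 0}"
      using inv[of l] * by (auto simp: le_less)
    then have "{..l} \<subseteq> fstd ` set (list_decode l)"
      using support_lookup by blast
    then have "card {..l} \<le> card (fstd ` set (list_decode l))"
      by (intro card_mono) auto
    also have "\<dots> \<le> card (set (list_decode l))"
      by (rule card_image_le) simp
    also have "\<dots> \<le> l"
      using card_length[of "list_decode l"] length_list_decode[of l] by linarith
    finally show False by simp
  qed
  then have "(LEAST i. lookup l i \<noteq> 1) = ?r l"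
    using inv[of l] by (intro Least_equality) (auto simp: not_le[symmetric])
  then show ?thesis
    by (simp add: value_code_def unary_value_def)
qed

lemma prog_value:
  assumes "prog a"
  shows "prog (\<lambda>q p x. unary_value (lookup (a q p x)))"
  unfolding value_code[symmetric] value_code_def
  by (intro prog_rec prog_if prog_pred_eq prog_lookup prog_Suc prog_snd prog_fst prog_id prog_const assms prog_comp[OF assms])

text \<open>
  A configuration is coded as \<open>(state, heads, tapes)\<close>, where \<open>heads\<close> is an association list and \<open>tapes\<close> an
  association list of association lists. As \<open>0\<close> codes the empty list and the default value is \<open>0\<close>,
  untouched tapes are blank.
\<close>

definition cfg :: "nat \<Rightarrow> config" where
  "cfg c = \<lparr>state = fstd c, tape = (\<lambda>t. lookup (lookup (sndd (sndd c)) t)),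
     head = lookup (fstd (sndd c))\<rparr>"

definition init_code :: "nat \<Rightarrow> nat" where
  "init_code k = prod_encode (0, prod_encode (0, insert_code 0 0 (unary_code k)))"

lemma cfg_init_code: "cfg (init_code k) = init k"
  by (auto simp: cfg_def init_code_def init_def fun_eq_iff)

lemma prog_init_code: "prog a \<Longrightarrow> prog (\<lambda>q p x. init_code (a q p x))"
  unfolding init_code_def by (intro prog_pair prog_const prog_insert prog_unary_code)

text \<open>Works on codes of transitions directly; \<open>0\<close> signals a halting
  configuration, any other result is the successor of the applicable code.\<close>

definition next_code :: "nat \<Rightarrow> nat \<Rightarrow> nat" where
  "next_code M c = find_code (\<lambda>d. fstd d = fstd c \<and> fstd (sndd (sndd d)) =
     lookup (lookup (sndd (sndd c)) (fstd (sndd d))) (lookup (fstd (sndd c)) (fstd (sndd d)))) M"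

lemma prog_next_code:
  assumes "prog a" "prog b"
  shows "prog (\<lambda>q p x. next_code (a q p x) (b q p x))"
  unfolding next_code_def
  by (intro prog_find_code prog_pred_conj prog_pred_eq prog_lookup prog_fst prog_snd prog_id assms prog_comp[OF assms(2)])

text \<open>Numbering as in \<open>decode_action\<close>: 0 and 1 move, 2 and 3 query, larger
  numbers write.\<close>

definition head_code :: "nat \<Rightarrow> nat \<Rightarrow> nat" where
  "head_code act h = (if act = 0 then h - 1 else if act = 1 then h + 1 else if act \<le> 3 then 0 else h)"

definition tape_code :: "baire \<Rightarrow> baire \<Rightarrow> nat \<Rightarrow> nat \<Rightarrow> nat \<Rightarrow> nat" where
  "tape_code q p act h l = (if act \<le> 1 then l else if act = 2 then unary_code (q (unary_value (lookup l)))
     else if act = 3 then unary_code (p (unary_value (lookup l))) else insert_code l h (act - 4))"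

definition apply_code :: "baire \<Rightarrow> baire \<Rightarrow> nat \<Rightarrow> nat \<Rightarrow> nat \<Rightarrow> nat \<Rightarrow> nat \<Rightarrow> nat" where
  "apply_code q p t act s' H T = prod_encode (s', prod_encode
     (insert_code H t (head_code act (lookup H t)),
      insert_code T t (tape_code q p act (lookup H t) (lookup T t))))"

text \<open>Halting configurations are fixed points, so a result remains readable at all later
  stages.\<close>

definition step_code :: "baire \<Rightarrow> baire \<Rightarrow> nat \<Rightarrow> nat \<Rightarrow> nat" where
  "step_code q p M c = (if next_code M c = 0 then c else
     apply_code q p (fstd (sndd (next_code M c - 1)))
       (fstd (sndd (sndd (sndd (next_code M c - 1)))))
       (sndd (sndd (sndd (sndd (next_code M c - 1))))) (fstd (sndd c)) (sndd (sndd c)))"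

lemma prog_head_code: "prog a \<Longrightarrow> prog b \<Longrightarrow> prog (\<lambda>q p x. head_code (a q p x) (b q p x))"
  unfolding head_code_def
  by (intro prog_if prog_pred_eq prog_pred_le prog_diff prog_add prog_const)

text \<open>The simulated oracle and input are computed from the real ones and from a parameter.
  Later the simulated input is \<open>enum e x\<close>, with \<open>x\<close> varying.\<close>

lemma prog_tape_code:
  assumes "prog (\<lambda>q p z. Q q p (fstd z) (sndd z))" "prog (\<lambda>q p z. P q p (fstd z) (sndd z))"
    and "prog x" "prog a" "prog b" "prog c"
  shows "prog (\<lambda>q p z. tape_code (Q q p (x q p z)) (P q p (x q p z)) (a q p z) (b q p z) (c q p z))"
  unfolding tape_code_def
  by (intro prog_if prog_pred_eq prog_pred_le prog_diff prog_insert prog_unary_code prog_value prog_const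
      prog_app2[OF assms(1)] prog_app2[OF assms(2)] assms(3-))

lemma prog_apply_code:
  assumes "prog (\<lambda>q p z. Q q p (fstd z) (sndd z))" "prog (\<lambda>q p z. P q p (fstd z) (sndd z))"
    and "prog x" "prog t" "prog a" "prog s" "prog b" "prog c"
  shows "prog (\<lambda>q p z. apply_code (Q q p (x q p z)) (P q p (x q p z))
    (t q p z) (a q p z) (s q p z) (b q p z) (c q p z))"
  unfolding apply_code_def
  by (intro prog_pair prog_insert prog_lookup prog_head_code prog_tape_code[OF assms(1,2)] assms(3-))

lemma prog_step_code:
  assumes "prog (\<lambda>q p z. Q q p (fstd z) (sndd z))" "prog (\<lambda>q p z. P q p (fstd z) (sndd z))"
    and "prog x" "prog a" "prog b"
  shows "prog (\<lambda>q p z. step_code (Q q p (x q p z)) (P q p (x q p z)) (a q p z) (b q p z))"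
  unfolding step_code_def
  by (intro prog_if prog_pred_eq prog_const prog_next_code prog_apply_code[OF assms(1,2)] prog_fst prog_snd prog_diff assms(3-))

section \<open>Correctness of the simulation\<close>

lemma find_map: "find P (map f xs) = map_option f (find (P \<circ> f) xs)"
  by (induction xs) auto

lemma cfg_apply_code:
  "cfg (apply_code q p t act s' (fstd (sndd c)) (sndd (sndd c))) =
     (perform q p (decode_action act) t (cfg c))\<lparr>state := s'\<rparr>"
proof -
  consider "act = 0" | "act = 1" | "act = 2" | "act = 3" | "act \<ge> 4" by linarith
  then show ?thesis
    by cases (auto simp: cfg_def apply_code_def head_code_def tape_code_def decode_action_def
        answer_def fun_eq_iff)
qed

lemma decode_transition_eq:
  "decode_transition d = (fstd d, fstd (sndd d), fstd (sndd (sndd d)),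
     decode_action (fstd (sndd (sndd (sndd d)))), sndd (sndd (sndd (sndd d))))"
  by (simp add: decode_transition_def case_prod_beta Let_def)

lemma step_cfg:
  "step (machine M) q p (cfg c) = (if next_code M c = 0 then None else Some (cfg (step_code q p M c)))"
proof -
  let ?R = "find (\<lambda>d. fstd d = fstd c \<and> fstd (sndd (sndd d)) =
     lookup (lookup (sndd (sndd c)) (fstd (sndd d))) (lookup (fstd (sndd c)) (fstd (sndd d)))) (list_decode M)"
  have nc: "next_code M c = (case ?R of None \<Rightarrow> 0 | Some y \<Rightarrow> Suc y)"
    by (simp add: next_code_def find_code_def)
  have "find (\<lambda>(s, t, a, act, s'). s = state (cfg c) \<and> a = tape (cfg c) t (head (cfg c) t)) (machine M) =
      map_option decode_transition ?R"
    by (simp add: machine_def find_map o_def decode_transition_eq cfg_def)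
  then show ?thesis
    by (cases ?R) (simp_all add: step_def nc step_code_def cfg_apply_code decode_transition_eq)
qed

definition run :: "baire \<Rightarrow> baire \<Rightarrow> nat \<Rightarrow> nat \<Rightarrow> nat \<Rightarrow> nat" where
  "run q p M k s = (step_code q p M ^^ s) (init_code k)"

lemma run_Suc: "run q p M k (Suc s) = step_code q p M (run q p M k s)"
  by (simp add: run_def)

text \<open>\<open>0\<close> means that there is no result yet, and \<open>Suc v\<close> that
  \<open>v\<close> is the result. For a decision machine, 2 is thus yes and 1 is no.\<close>

definition output_within :: "baire \<Rightarrow> baire \<Rightarrow> nat \<Rightarrow> nat \<Rightarrow> nat \<Rightarrow> nat" where
  "output_within q p M k s = (if next_code M (run q p M k s) = 0
     then Suc (unary_value (lookup (lookup (sndd (sndd (run q p M k s))) 0))) else 0)"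

lemma prog_output_within:
  assumes "prog (\<lambda>q p z. Q q p (fstd z) (sndd z))" "prog (\<lambda>q p z. P q p (fstd z) (sndd z))"
    and "prog a" "prog b" "prog c"
  shows "prog (\<lambda>q p z. output_within (Q q p z) (P q p z) (a q p z) (b q p z) (c q p z))"
proof -
  have "prog (\<lambda>q p z. run (Q q p z) (P q p z) (a q p z) (b q p z) (c q p z))"
    unfolding run_def
    by (intro prog_iter prog_init_code prog_step_code[OF assms(1,2)] assms prog_fst prog_snd prog_id prog_comp[OF assms(3)])
  then show ?thesis
    unfolding output_within_def
    by (intro prog_if prog_pred_eq prog_next_code prog_const prog_Suc prog_value prog_lookup prog_snd assms(3))
qed

lemma run_halted:
  assumes "next_code M (run q p M k s) = 0" "s \<le> s'"
  shows "run q p M k s' = run q p M k s"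
  using assms(2,1)
proof (induction s' rule: dec_induct)
  case (step n)
  then show ?case by (simp add: run_Suc step_code_def)
qed simp

lemma output_within_mono:
  assumes "output_within q p M k s = Suc v" "s \<le> s'"
  shows "output_within q p M k s' = Suc v"
  using assms run_halted[of M q p k s s'] unfolding output_within_def by (auto split: if_splits)

lemma steps_run: "steps (machine M) q p (init k) (cfg (run q p M k s))"
proof (induction s)
  case 0
  then show ?case by (simp add: run_def cfg_init_code)
next
  case (Suc s)
  show ?case
  proof (cases "next_code M (run q p M k s) = 0")
    case True
    then show ?thesis using Suc by (simp add: run_Suc step_code_def)
  next
    case False
    then have "step (machine M) q p (cfg (run q p M k s)) = Some (cfg (run q p M k (Suc s)))"
      by (simp add: step_cfg run_Suc)
    with Suc show ?thesis by (rule rtranclp.rtrancl_into_rtrancl)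
  qed
qed

lemma run_steps: "steps (machine M) q p (init k) c \<Longrightarrow> \<exists>s. c = cfg (run q p M k s)"
proof (induction rule: rtranclp_induct)
  case base
  have "init k = cfg (run q p M k 0)" by (simp add: run_def cfg_init_code)
  then show ?case by blast
next
  case (step c d)
  then obtain s where s: "c = cfg (run q p M k s)" by blast
  then have "d = cfg (run q p M k (Suc s))"
    using step(2) by (simp add: step_cfg run_Suc split: if_splits)
  then show ?case by blast
qed

lemma halts_with_iff:
  "halts_with (machine M) q p k v \<longleftrightarrow> (\<exists>s. output_within q p M k s = Suc v)"
proof
  assume "halts_with (machine M) q p k v"
  then obtain c where c: "steps (machine M) q p (init k) c" "step (machine M) q p c = None"
    "unary_value (tape c 0) = v"
    unfolding halts_with_def by blast
  then obtain s where "c = cfg (run q p M k s)" using run_steps by blast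
  moreover from this have "next_code M (run q p M k s) = 0"
    using c(2) by (simp add: step_cfg split: if_splits)
  ultimately have "output_within q p M k s = Suc v"
    using c(3) by (simp add: output_within_def cfg_def)
  then show "\<exists>s. output_within q p M k s = Suc v" by blast
next
  assume "\<exists>s. output_within q p M k s = Suc v"
  then obtain s where "output_within q p M k s = Suc v" by blast
  then have "step (machine M) q p (cfg (run q p M k s)) = None"
    "unary_value (tape (cfg (run q p M k s)) 0) = v"
    unfolding step_cfg by (auto simp: output_within_def cfg_def split: if_splits)
  then show "halts_with (machine M) q p k v"
    unfolding halts_with_def using steps_run by blast
qed

text \<open>All stages that report a result report the same one, so a nonzero entry is exactly a
  report above 1.\<close>

lemma machine_fun_output:
  assumes "machine_fun M q p = Some r"
  shows "r k \<noteq> 0 \<longleftrightarrow> (\<exists>s. 1 < output_within q p M k s)"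
proof -
  obtain s where s: "output_within q p M k s = Suc (r k)"
    using machine_fun_SomeD[OF assms] halts_with_iff by blast
  have "r k = v" if "output_within q p M k s' = Suc v" for s' v
    using that s output_within_mono by (metis nat.inject nle_le)
  then show ?thesis
    using s by (metis One_nat_def Suc_less_eq Suc_lessE neq0_conv)
qed

section \<open>Continuity of machine functions\<close>

lemma run_use: "\<exists>N. \<forall>p'. (\<forall>i<N. p' i = p i) \<longrightarrow> run q p' M k s = run q p M k s"
proof (induction s)
  case 0
  then show ?case by (simp add: run_def)
next
  case (Suc s)
  then obtain N where N: "\<And>p'. \<forall>i<N. p' i = p i \<Longrightarrow> run q p' M k s = run q p M k s" by blast
  let ?c = "run q p M k s"
  \<comment> \<open>The tape on which the next entry acts; the number on it is the only place where
    this step can query \<open>p\<close>.\<close>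
  let ?l = "lookup (sndd (sndd ?c)) (fstd (sndd (next_code M ?c - 1)))"
  have "run q p' M k (Suc s) = run q p M k (Suc s)"
    if p': "\<forall>i<max N (Suc (unary_value (lookup ?l))). p' i = p i" for p'
  proof -
    have eq: "run q p' M k s = ?c"
      by (rule N) (use p' in simp)
    have "p' (unary_value (lookup ?l)) = p (unary_value (lookup ?l))"
      by (rule p'[rule_format]) simp
    then have "step_code q p' M ?c = step_code q p M ?c"
      by (simp add: step_code_def apply_code_def tape_code_def)
    with eq show ?thesis
      by (simp add: run_Suc)
  qed
  then show ?case by blast
qed

lemma eventually_output_within:
  "\<forall>\<^sub>F p' in nhds p. output_within q p' M k s = output_within q p M k s"
proof -
  obtain N where N: "\<And>p'. \<forall>i<N. p' i = p i \<Longrightarrow> run q p' M k s = run q p M k s"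
    using run_use by blast
  have ev: "\<forall>\<^sub>F p' in nhds p. p' i = p i" for i
  proof -
    have "open ((\<lambda>p' :: baire. p' i) -` {p i})"
      by (rule open_vimage[OF open_discrete continuous_on_product_coordinates])
    then show ?thesis
      unfolding eventually_nhds by blast
  qed
  have "\<forall>\<^sub>F p' in nhds p. \<forall>i\<in>{..<N}. p' i = p i"
    by (rule eventually_ball_finite) (auto intro: ev)
  then show ?thesis
  proof (rule eventually_mono)
    fix p'
    assume "\<forall>i\<in>{..<N}. p' i = p i"
    then have "run q p' M k s = run q p M k s" by (intro N) simp
    then show "output_within q p' M k s = output_within q p M k s"
      by (simp add: output_within_def)
  qed
qed

text \<open>A result obtained within \<open>s\<close> steps persists under small changes of the
  input. This supplies the continuous realizer that membership in
  \<open>points (opens (opens X))\<close> demands.\<close>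

lemma continuous_machine_fun: "continuous_partial (machine_fun M q)"
  unfolding continuous_partial_def
proof (rule continuous_on_coordinatewise_then_product)
  fix k
  show "continuous_on (dom (machine_fun M q)) (\<lambda>p. the (machine_fun M q p) k)"
    unfolding continuous_on_def
  proof
    fix p
    assume "p \<in> dom (machine_fun M q)"
    then obtain r where r: "machine_fun M q p = Some r" by blast
    then obtain s where s: "output_within q p M k s = Suc (r k)"
      using machine_fun_SomeD halts_with_iff by blast
    have "r' k = r k" if "machine_fun M q p' = Some r'" "output_within q p' M k s = Suc (r k)" for p' r'
      using that machine_fun_SomeD halts_with_iff halts_with_unique by blast
    then have "\<forall>\<^sub>F p' in at p within dom (machine_fun M q). the (machine_fun M q p') k = r k"
      unfolding eventually_at_filter
      by (intro eventually_mono[OF eventually_output_within[where q = q and M = M and k = k and s = s]]) (auto simp: s)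
    then show "((\<lambda>p. the (machine_fun M q p) k) \<longlongrightarrow> the (machine_fun M q p) k)
        (at p within dom (machine_fun M q))"
      by (simp add: r tendsto_discrete)
  qed
qed


section \<open>Open and compact sets of well-quasiorders\<close>

text \<open>A zero marks each change of \<open>F\<close>, and the entry right after it announces
  \<open>m\<close> anew. Treating \<open>k = 0\<close> like the position after a change covers a
  constant \<open>F\<close>.\<close>

lemma Delta_mind_changes:
  fixes F :: "nat \<Rightarrow> nat"
  assumes "finite {k. F (Suc k) \<noteq> F k}"
  obtains N r where "\<And>k. N \<le> k \<Longrightarrow> F k = F N"
    and "Delta (\<lambda>k. if F (Suc k) \<noteq> F k then 0 else if k = 0 then Suc m
           else if F k \<noteq> F (k - 1) then Suc m else Suc (F k)) = Some r"
    and "r 0 = m" "\<And>i. r (Suc i) = F N"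
proof -
  let ?Z = "{k. F (Suc k) \<noteq> F k}"
  define G where "G = (\<lambda>k. if F (Suc k) \<noteq> F k then 0 else if k = 0 then Suc m
           else if F k \<noteq> F (k - 1) then Suc m else Suc (F k))"
  define N where "N = (if ?Z = {} then 0 else 1 + Max ?Z)"
  have const: "F (Suc k) = F k" if "N \<le> k" for k
  proof (rule ccontr)
    assume "F (Suc k) \<noteq> F k"
    then have "k \<in> ?Z" by simp
    then have "k \<le> Max ?Z" "?Z \<noteq> {}" using assms by auto
    moreover from this have "N = 1 + Max ?Z" unfolding N_def by (intro if_not_P)
    ultimately show False using that by linarith
  qed
  have FN: "F k = F N" if "N \<le> k" for k
    using that by (induction rule: dec_induct) (auto simp: const)
  \<comment> \<open>\<open>N\<close> is where \<open>Delta\<close> starts reading; being initial or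
    right after a change, it carries \<open>Suc m\<close>.\<close>
  have "N = 0 \<or> F N \<noteq> F (N - 1)"
  proof (cases "?Z = {}")
    case False
    then have "Max ?Z \<in> ?Z" using assms by (rule Max_in[rotated])
    moreover have "N = 1 + Max ?Z" unfolding N_def using False by (rule if_not_P)
    ultimately show ?thesis by simp
  qed (simp add: N_def)
  then have "G N = Suc m"
    using const[of N] unfolding G_def by auto
  moreover have "G (Suc i + N) = Suc (F N)" for i
    using const[of "Suc i + N"] const[of "i + N"] FN[of "Suc i + N"] unfolding G_def by auto
  moreover have zeros: "{k. G k = 0} = ?Z" by (auto simp: G_def)
  have "Delta G = Some (\<lambda>i. G (i + N) - 1)"
    unfolding Delta_def Let_def zeros N_def using assms by (rule if_P)
  ultimately show ?thesis
    using that[of N "\<lambda>i. G (i + N) - 1", OF FN, folded G_def] by simp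
qed

text \<open>If no finite part generated \<open>U\<close>, elements of \<open>U\<close> above no
  earlier choice could be chosen forever, giving a bad sequence.\<close>

lemma wqo_finite_basis:
  assumes "well_quasiorder le" "\<And>x y. x \<in> U \<Longrightarrow> le x y \<Longrightarrow> y \<in> U"
  obtains B where "finite B" "U = {x. \<exists>y\<in>B. le y x}"
proof -
  have "\<exists>B. finite B \<and> B \<subseteq> U \<and> (\<forall>x\<in>U. \<exists>y\<in>B. le y x)"
  proof (rule ccontr)
    assume no: "\<nexists>B. finite B \<and> B \<subseteq> U \<and> (\<forall>x\<in>U. \<exists>y\<in>B. le y x)"
    have "\<exists>a. \<forall>n :: nat. a n \<in> U \<and> (\<forall>i<n. \<not> le (a i) (a n))"
    proof (rule dependent_wellorder_choice)
      fix n :: nat and a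
      assume "\<And>y. y < n \<Longrightarrow> a y \<in> U \<and> (\<forall>i<y. \<not> le (a i) (a y))"
      then have "a ` {..<n} \<subseteq> U" by auto
      then show "\<exists>r. r \<in> U \<and> (\<forall>i<n. \<not> le (a i) r)"
        using no[simplified, rule_format, of "a ` {..<n}"] by auto
    qed auto
    then show False
      using assms(1) unfolding well_quasiorder_def by metis
  qed
  then obtain B where B: "finite B" "B \<subseteq> U" "\<forall>x\<in>U. \<exists>y\<in>B. le y x"
    by blast
  then have "U = {x. \<exists>y\<in>B. le y x}"
    using assms(2) by blast
  with B(1) show ?thesis by (rule that)
qed

text \<open>Basic open sets of the product topology restrict only finitely many coordinates.\<close>

lemma eventually_nhds_prefix:
  assumes "\<forall>\<^sub>F p' in nhds (p :: baire). P p'"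
  obtains n where "\<And>p'. (\<forall>i<n. p' i = p i) \<Longrightarrow> P p'"
proof -
  obtain S where S: "open S" "p \<in> S" "\<And>x. x \<in> S \<Longrightarrow> P x"
    using assms by (auto simp: eventually_nhds)
  obtain X where X: "p \<in> Pi\<^sub>E UNIV X" "finite {i. X i \<noteq> UNIV}" "Pi\<^sub>E UNIV X \<subseteq> S"
    using product_topology_open_contains_basis[of "\<lambda>_. euclidean" UNIV S p] S
    by (auto simp: open_fun_def)
  obtain n where n: "\<And>i. X i \<noteq> UNIV \<Longrightarrow> i < n"
    using X(2) by (auto simp: finite_nat_set_iff_bounded)
  have "P p'" if "\<forall>i<n. p' i = p i" for p'
  proof (rule S(3), rule subsetD[OF X(3)])
    show "p' \<in> Pi\<^sub>E UNIV X"
      using X(1) n that by (auto simp: PiE_iff) (metis UNIV_I)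
  qed
  then show ?thesis using that by blast
qed

section \<open>Open sets and their names\<close>

lemma points_opens:
  "U \<in> points (opens X) \<longleftrightarrow> U \<subseteq> points X \<and> continuous_between X Sierpinski (char_fun X U)"
  by (auto simp: opens_def function_space_def char_fun_def Let_def)

lemma name_opens:
  "name (opens X) p U \<longleftrightarrow> U \<in> points (opens X) \<and>
     realizes (machine_fun (p 0) (\<lambda>i. p (Suc i))) X Sierpinski (char_fun X U)"
  by (auto simp: opens_def function_space_def char_fun_def Let_def)

lemma continuous_between_SierpinskiI:
  "continuous_partial F \<Longrightarrow> realizes F X Sierpinski f \<Longrightarrow> continuous_between X Sierpinski f"
  by (auto simp: continuous_between_def Sierpinski_def)

lemma open_Av_upward_closed:
  assumes "quasiorder le" "U \<in> points (opens (Av le))" "x \<in> U" "le x y"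
  shows "y \<in> U"
proof -
  have refl: "le n n" and trans: "le k m \<Longrightarrow> le m n \<Longrightarrow> le k n" for k m n
    using assms(1) by (auto simp: quasiorder_def dest: reflpD transpD)
  obtain F where F: "continuous_partial F" "realizes F (Av le) Sierpinski (char_fun (Av le) U)"
    using assms(2) by (auto simp: points_opens continuous_between_def)
  have real: "\<exists>r. F p = Some r \<and> (n \<in> U \<longleftrightarrow> r \<noteq> (\<lambda>_. 0))" if "{k. le k n} = range p" for p n
    using F(2) that by (auto simp: realizes_def Av_def Sierpinski_def char_fun_def)
  \<comment> \<open>A canonical name of \<open>n\<close>, with \<open>n\<close> itself as
    filler.\<close>
  define P where "P = (\<lambda>n i. if le i n then i else n)"
  have range_P: "range (P n) = {k. le k n}" for n
    by (auto simp: P_def refl)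
  obtain r where r: "F (P x) = Some r" "r \<noteq> (\<lambda>_. 0)"
    using real[of x "P x"] range_P assms(3) by auto
  then obtain k where k: "r k \<noteq> 0" by auto
  have "continuous_on (dom F) (\<lambda>p. the (F p) k)"
    using F(1) unfolding continuous_partial_def by (rule continuous_on_product_then_coordinatewise)
  then have "((\<lambda>p. the (F p) k) \<longlongrightarrow> r k) (at (P x) within dom F)"
    using r(1) unfolding continuous_on_def by force
  then have "\<forall>\<^sub>F p in nhds (P x). p \<in> dom F \<longrightarrow> the (F p) k = r k"
    using r(1) unfolding tendsto_discrete eventually_at_filter by (auto elim: eventually_mono)
  then obtain n where n: "\<And>p. \<forall>i<n. p i = P x i \<Longrightarrow> p \<in> dom F \<longrightarrow> the (F p) k = r k"
    by (rule eventually_nhds_prefix) blast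
  \<comment> \<open>The prefix lists only elements below \<open>x\<close>, hence below
    \<open>y\<close> by transitivity; appending a full name of \<open>y\<close> gives a name of
    \<open>y\<close>.\<close>
  let ?p = "\<lambda>i. if i < n then P x i else P y (i - n)"
  have "range ?p = {k. le k y}"
  proof
    show "range ?p \<subseteq> {k. le k y}"
      using assms(4) trans refl by (auto simp: P_def)
    show "{k. le k y} \<subseteq> range ?p"
    proof
      fix j
      assume "j \<in> {k. le k y}"
      then show "j \<in> range ?p"
        by (intro range_eqI[of _ _ "j + n"]) (simp add: P_def)
    qed
  qed
  then obtain r' where r': "F ?p = Some r'" "y \<in> U \<longleftrightarrow> r' \<noteq> (\<lambda>_. 0)"
    using real[of y ?p] by auto
  with n[of ?p] have "r' k = r k" by auto
  with k r'(2) show ?thesis by auto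
qed

text \<open>
  Here \<open>e\<close> decides the order. The argument codes an element and a number of steps; \<open>x\<close> itself serves as
  filler until \<open>e\<close> has answered.
\<close>

definition enum :: "nat \<Rightarrow> nat \<Rightarrow> baire" where
  "enum e x i = (if output_within (\<lambda>_. 0) (\<lambda>_. 0) e (prod_encode (fstd i, x)) (sndd i) = 2
     then fstd i else x)"

text \<open>The name \<open>p\<close> consists of a machine number and an oracle. One stage
  \<open>j\<close> bounds both the output positions inspected and the steps simulated, so acceptance
  is decidable and monotone in \<open>j\<close>.\<close>

definition accepts :: "nat \<Rightarrow> baire \<Rightarrow> nat \<Rightarrow> nat \<Rightarrow> bool" where
  "accepts e p x j \<longleftrightarrow> (\<exists>k<j. 1 < output_within (\<lambda>i. p (Suc i)) (enum e x) (p 0) k j)"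

lemma prog_pred_accepts:
  assumes "prog a" "prog b"
  shows "prog_pred (\<lambda>q p x. accepts e p (a q p x) (b q p x))"
proof -
  have enum: "prog (\<lambda>q p z. enum e (a q p (f q p z)) (g q p z))" if "prog f" "prog g" for f g
    unfolding enum_def
    by (intro prog_if prog_pred_eq prog_output_within prog_const prog_pair prog_fst prog_snd that prog_comp[OF assms(1)])
  show ?thesis
    unfolding accepts_def
    by (intro prog_pred_bex prog_pred_less prog_output_within prog_const prog_input prog_Suc prog_snd prog_fst prog_id enum
        assms prog_comp[OF assms(2)])
qed

lemma accepts_mono:
  assumes "accepts e p x j" "j \<le> j'"
  shows "accepts e p x j'"
proof -
  obtain k where k: "k < j" "1 < output_within (\<lambda>i. p (Suc i)) (enum e x) (p 0) k j"
    using assms(1) by (auto simp: accepts_def)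
  then obtain v where "output_within (\<lambda>i. p (Suc i)) (enum e x) (p 0) k j = Suc v"
    using gr0_implies_Suc by fastforce
  with output_within_mono[OF this assms(2)] k assms(2) show ?thesis
    unfolding accepts_def by (metis order_less_le_trans)
qed

text \<open>For the constant oracle \<open>l\<close>, the output is nonzero iff all elements of the
  list coded by \<open>l\<close> are accepted at a common stage.\<close>

definition inclusion_output :: "nat \<Rightarrow> baire \<Rightarrow> baire \<Rightarrow> baire" where
  "inclusion_output e q p j = (if \<forall>x\<in>set (list_decode (q 0)). accepts e p x j then 1 else 0)"

lemma prog_inclusion_output: "prog (inclusion_output e)"
proof -
  have "prog (\<lambda>q p j. if \<forall>x\<in>set (list_decode (q 0)). accepts e p x j then 1 else 0)"
    by (intro prog_if prog_pred_list_all prog_pred_accepts prog_oracle prog_const prog_fst prog_snd prog_id)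
  then show ?thesis
    by (simp add: inclusion_output_def[abs_def])
qed

text \<open>\<open>k\<close> codes a candidate and a bound on the steps, so every candidate returns
  with every bound and no slow computation is missed. The value 1 is a definite no from the
  decider.\<close>

primrec basis :: "nat \<Rightarrow> baire \<Rightarrow> nat \<Rightarrow> nat" where
  "basis e p 0 = 0"
| "basis e p (Suc k) =
     (if accepts e p (fstd k) (sndd k) \<and> (\<forall>y\<in>set (list_decode (basis e p k)).
          output_within (\<lambda>_. 0) (\<lambda>_. 0) e (prod_encode (y, fstd k)) (sndd k) = 1)
      then Suc (prod_encode (fstd k, basis e p k)) else basis e p k)"

lemma prog_basis:
  assumes "prog a"
  shows "prog (\<lambda>q p x. basis e p (a q p x))"
proof -
  let ?g = "\<lambda>p k l. if accepts e p (fstd k) (sndd k) \<and> (\<forall>y\<in>set (list_decode l).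
          output_within (\<lambda>_. 0) (\<lambda>_. 0) e (prod_encode (y, fstd k)) (sndd k) = 1)
      then Suc (prod_encode (fstd k, l)) else l"
  have "prog (\<lambda>q p x. rec_nat 0 (?g p) (a q p x))"
    by (intro prog_rec prog_if prog_pred_conj prog_pred_list_all prog_pred_accepts prog_pred_eq prog_output_within prog_Suc prog_pair
        prog_const prog_fst prog_snd prog_id assms)
  moreover have "rec_nat 0 (?g p) k = basis e p k" for p k
    by (induction k) simp_all
  ultimately show ?thesis
    by simp
qed

lemma basis_mono: "j \<le> k \<Longrightarrow> set (list_decode (basis e p j)) \<subseteq> set (list_decode (basis e p k))"
  by (induction k rule: dec_induct) auto

lemma basis_change:
  assumes "basis e p (Suc k) \<noteq> basis e p k"
  shows "accepts e p (fstd k) (sndd k)" "fstd k \<in> set (list_decode (basis e p (Suc k)))"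
    "y \<in> set (list_decode (basis e p k)) \<Longrightarrow>
       output_within (\<lambda>_. 0) (\<lambda>_. 0) e (prod_encode (y, fstd k)) (sndd k) = 1"
  using assms by (auto split: if_splits)

lemma basis_accepted: "x \<in> set (list_decode (basis e p k)) \<Longrightarrow> \<exists>j. accepts e p x j"
  by (induction k) (auto split: if_splits)

text \<open>
  After the last change the output is \<open>m, l, l, ...\<close> shifted by one, where \<open>l\<close> is the limit of the bases: a name of
  the set generated by \<open>l\<close>, if machine \<open>m\<close> computes \<open>inclusion_output e\<close>.
\<close>

definition nabla_output :: "nat \<Rightarrow> nat \<Rightarrow> baire \<Rightarrow> baire" where
  "nabla_output e m p k = (if basis e p (Suc k) \<noteq> basis e p k then 0 else if k = 0 then Suc m
     else if basis e p k \<noteq> basis e p (k - 1) then Suc m else Suc (basis e p k))"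

lemma prog_nabla_output: "prog (\<lambda>q. nabla_output e m)"
proof -
  have "prog (\<lambda>q p k. nabla_output e m p k)"
    unfolding nabla_output_def
    by (intro prog_if prog_pred_not prog_pred_eq prog_basis prog_Suc prog_diff prog_const prog_id)
  then show ?thesis by simp
qed

section \<open>Correctness for a decidable quasiorder\<close>

context
  fixes le e
  assumes qo: "quasiorder le"
    and decides: "\<And>i j. halts_with (machine e) (\<lambda>_. 0) (\<lambda>_. 0) (prod_encode (i, j)) (if le i j then 1 else 0)"
begin

lemma ex_output: "\<exists>s. output_within (\<lambda>_. 0) (\<lambda>_. 0) e (prod_encode (i, j)) s = (if le i j then 2 else 1)"
  using decides[of i j] by (auto simp: halts_with_iff numeral_2_eq_2 split: if_splits)

lemma output_le:
  assumes "output_within (\<lambda>_. 0) (\<lambda>_. 0) e (prod_encode (i, j)) s = Suc v"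
  shows "v = (if le i j then 1 else 0)"
  using assms decides halts_with_iff halts_with_unique by blast

text \<open>Every element below \<open>x\<close> is confirmed within some number of steps, and the
  filler \<open>x\<close> is admissible by reflexivity.\<close>

lemma name_enum: "name (Av le) (enum e x) x"
proof -
  have "le x x" using qo by (auto simp: quasiorder_def dest: reflpD)
  then have "range (enum e x) \<subseteq> {k. le k x}"
    by (auto simp: enum_def numeral_2_eq_2 dest!: output_le split: if_splits)
  moreover have "k \<in> range (enum e x)" if k: "le k x" for k
  proof -
    obtain s where "output_within (\<lambda>_. 0) (\<lambda>_. 0) e (prod_encode (k, x)) s = 2"
      using ex_output[of k x] k by auto
    then have "enum e x (prod_encode (k, s)) = k"
      by (simp add: enum_def)
    then show ?thesis by (metis rangeI)
  qed
  ultimately show ?thesis by (auto simp: Av_def)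
qed

lemma mem_iff_accepts:
  assumes "name (opens (Av le)) p U"
  shows "x \<in> U \<longleftrightarrow> (\<exists>j. accepts e p x j)"
proof -
  obtain r where "machine_fun (p 0) (\<lambda>i. p (Suc i)) (enum e x) = Some r"
    "name Sierpinski r (char_fun (Av le) U x)"
    using assms name_enum[of x] unfolding name_opens realizes_def by blast
  then have r: "machine_fun (p 0) (\<lambda>i. p (Suc i)) (enum e x) = Some r" "x \<in> U \<longleftrightarrow> r \<noteq> (\<lambda>_. 0)"
    by (simp_all add: Sierpinski_def char_fun_def Av_def)
  have "r \<noteq> (\<lambda>_. 0) \<longleftrightarrow> (\<exists>k s. 1 < output_within (\<lambda>i. p (Suc i)) (enum e x) (p 0) k s)"
    using machine_fun_output[OF r(1)] by auto
  also have "\<dots> \<longleftrightarrow> (\<exists>j. accepts e p x j)"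
  proof
    assume "\<exists>k s. 1 < output_within (\<lambda>i. p (Suc i)) (enum e x) (p 0) k s"
    then obtain k s where ks: "1 < output_within (\<lambda>i. p (Suc i)) (enum e x) (p 0) k s" by blast
    then obtain v where v: "output_within (\<lambda>i. p (Suc i)) (enum e x) (p 0) k s = Suc v"
      using gr0_implies_Suc by fastforce
    \<comment> \<open>The stage has to exceed the output position \<open>k\<close> as well.\<close>
    have "output_within (\<lambda>i. p (Suc i)) (enum e x) (p 0) k (max s (Suc k)) = Suc v"
      by (rule output_within_mono[OF v]) simp
    then have "accepts e p x (max s (Suc k))"
      unfolding accepts_def using ks v by (intro exI[of _ k]) auto
    then show "\<exists>j. accepts e p x j" ..
  qed (auto simp: accepts_def)
  finally show ?thesis using r(2) by simp
qed

text \<open>The name is the number of the inclusion machine followed by the constant oracle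
  \<open>l\<close>, the code of finitely many generators of \<open>U\<close>.\<close>

lemma upward_closure_compact:
  assumes m: "\<And>q p. machine_fun m q p = Some (inclusion_output e q p)"
    and U: "U \<in> points (opens (Av le))" "U = {x. \<exists>y\<in>set (list_decode l). le y x}"
    and r: "r 0 = m" "\<And>i. r (Suc i) = l"
  shows "U \<in> points (compacts (Av le))" "name (compacts (Av le)) r U"
proof -
  let ?O = "opens (Av le)" and ?S = "open_supersets (Av le) U"
  have "realizes (machine_fun m (\<lambda>_. l)) ?O Sierpinski (char_fun ?O ?S)"
    unfolding realizes_def
  proof (intro allI impI)
    fix p V
    assume V: "name ?O p V"
    then have pts: "V \<in> points ?O" by (simp add: name_opens)
    have refl: "le n n" for n using qo by (auto simp: quasiorder_def dest: reflpD)
    \<comment> \<open>\<open>V\<close> is upward closed, and the generators belong to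
      \<open>U\<close> by reflexivity.\<close>
    have "U \<subseteq> V \<longleftrightarrow> (\<forall>x\<in>set (list_decode l). x \<in> V)"
      using open_Av_upward_closed[OF qo pts] refl unfolding U(2) by blast
    also have "\<dots> \<longleftrightarrow> (\<exists>j. \<forall>x\<in>set (list_decode l). accepts e p x j)"
    proof
      assume "\<forall>x\<in>set (list_decode l). x \<in> V"
      then obtain g where g: "\<And>x. x \<in> set (list_decode l) \<Longrightarrow> accepts e p x (g x)"
        using mem_iff_accepts[OF V] by metis
      \<comment> \<open>Finiteness enters here: the generators have a common stage of
        acceptance.\<close>
      have "accepts e p x (Max (g ` set (list_decode l)))" if "x \<in> set (list_decode l)" for x
        by (rule accepts_mono[OF g[OF that]]) (use that in simp)
      then show "\<exists>j. \<forall>x\<in>set (list_decode l). accepts e p x j" by blast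
    qed (use mem_iff_accepts[OF V] in blast)
    also have "\<dots> \<longleftrightarrow> inclusion_output e (\<lambda>_. l) p \<noteq> (\<lambda>_. 0)"
      by (auto simp: inclusion_output_def fun_eq_iff)
    finally have "name Sierpinski (inclusion_output e (\<lambda>_. l) p) (char_fun ?O ?S V)"
      using pts by (simp add: Sierpinski_def char_fun_def open_supersets_def)
    then show "\<exists>r. machine_fun m (\<lambda>_. l) p = Some r \<and> name Sierpinski r (char_fun ?O ?S V)"
      using m by simp
  qed
  moreover have "(\<lambda>i. r (Suc i)) = (\<lambda>_. l)" using r(2) by auto
  ultimately have "name (opens ?O) r ?S"
    using r(1) continuous_between_SierpinskiI[OF continuous_machine_fun]
    by (auto simp: name_opens points_opens open_supersets_def)
  moreover from this have "?S \<in> points (opens ?O)" by (simp add: name_opens)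
  \<comment> \<open>Saturation: \<open>U\<close> is one of its own open supersets.\<close>
  moreover have "U = \<Inter> ?S" using U(1) by (auto simp: open_supersets_def)
  ultimately show "U \<in> points (compacts (Av le))" "name (compacts (Av le)) r U"
    by (auto simp: compacts_def Let_def Av_def)
qed

text \<open>Among infinitely many added candidates, an earlier one would lie below a later one, but
  the later one was added only after the decider had denied this.\<close>

lemma finite_basis_changes:
  assumes "well_quasiorder le"
  shows "finite {k. basis e p (Suc k) \<noteq> basis e p k}"
proof (rule ccontr)
  assume inf: "infinite {k. basis e p (Suc k) \<noteq> basis e p k}" (is "infinite ?Z")
  note Z = enumerate_in_set[OF inf, unfolded mem_Collect_eq]
  obtain i j where ij: "i < j" "le (fstd (enumerate ?Z i)) (fstd (enumerate ?Z j))"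
    using assms[unfolded well_quasiorder_def, THEN conjunct2, rule_format,
        of "\<lambda>n. fstd (enumerate ?Z n)"] by blast
  \<comment> \<open>A candidate added at index \<open>k\<close> belongs to the basis from
    \<open>Suc k\<close> on.\<close>
  have "Suc (enumerate ?Z i) \<le> enumerate ?Z j"
    by (rule Suc_leI[OF enumerate_mono[OF ij(1) inf]])
  then have "fstd (enumerate ?Z i) \<in> set (list_decode (basis e p (enumerate ?Z j)))"
    by (rule subsetD[OF basis_mono basis_change(2)[OF Z]])
  then have "output_within (\<lambda>_. 0) (\<lambda>_. 0) e
      (prod_encode (fstd (enumerate ?Z i), fstd (enumerate ?Z j))) (sndd (enumerate ?Z j)) = Suc 0"
    unfolding One_nat_def[symmetric] by (rule basis_change(3)[OF Z])
  from output_le[OF this] ij(2) show False by simp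
qed

lemma basis_limit:
  assumes "name (opens (Av le)) p U" and N: "\<And>k. N \<le> k \<Longrightarrow> basis e p k = basis e p N"
  shows "U = {x. \<exists>y\<in>set (list_decode (basis e p N)). le y x}"
proof
  have pts: "U \<in> points (opens (Av le))" using assms(1) by (simp add: name_opens)
  show "{x. \<exists>y\<in>set (list_decode (basis e p N)). le y x} \<subseteq> U"
    using basis_accepted mem_iff_accepts[OF assms(1)] open_Av_upward_closed[OF qo pts] by blast
  show "U \<subseteq> {x. \<exists>y\<in>set (list_decode (basis e p N)). le y x}"
  proof (rule subsetI, rule ccontr)
    let ?B = "set (list_decode (basis e p N))"
    fix x
    assume "x \<in> U" and "x \<notin> {x. \<exists>y\<in>?B. le y x}"
    then have not: "\<not> le y x" if "y \<in> ?B" for y using that by blast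
    obtain j where j: "accepts e p x j"
      using mem_iff_accepts[OF assms(1)] \<open>x \<in> U\<close> by blast
    have "\<exists>s. output_within (\<lambda>_. 0) (\<lambda>_. 0) e (prod_encode (y, x)) s = Suc 0" if "y \<in> ?B" for y
      using ex_output[of y x] not[OF that] by simp
    then obtain g where g:
      "\<And>y. y \<in> ?B \<Longrightarrow> output_within (\<lambda>_. 0) (\<lambda>_. 0) e (prod_encode (y, x)) (g y) = Suc 0"
      by metis
    \<comment> \<open>A bound by which \<open>x\<close> is accepted and all comparisons with the
      limit basis are answered; \<open>s\<close> also pushes the code \<open>?k\<close> beyond
      \<open>N\<close>.\<close>
    define s where "s = Max (insert j (insert N (g ` ?B)))"
    have s: "j \<le> s" "N \<le> s" "\<And>y. y \<in> ?B \<Longrightarrow> g y \<le> s"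
      unfolding s_def by (rule Max_ge; simp)+
    let ?k = "prod_encode (x, s)"
    have "N \<le> ?k" using s(2) le_prod_encode_2[of s x] by linarith
    then have eq: "basis e p ?k = basis e p N" "basis e p (Suc ?k) = basis e p N"
      by (intro N; simp)+
    have "accepts e p x s" by (rule accepts_mono[OF j s(1)])
    moreover have "\<forall>y\<in>?B. output_within (\<lambda>_. 0) (\<lambda>_. 0) e (prod_encode (y, x)) s = 1"
      using output_within_mono[OF g s(3)] by simp
    ultimately have "basis e p (Suc ?k) = Suc (prod_encode (x, basis e p N))"
      using eq(1) by simp
    \<comment> \<open>A list code grows strictly when an element is added, so the basis would change
      after \<open>N\<close>.\<close>
    moreover have "basis e p N \<le> prod_encode (x, basis e p N)" by (rule le_prod_encode_2)
    ultimately show False using eq(2) by simp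
  qed
qed

end

theorem theorem47:
  fixes le :: "nat \<Rightarrow> nat \<Rightarrow> bool"
  assumes "well_quasiorder le"
    and "decidable_rel le"
  shows "nabla_computably_Noetherian (Av le)"
proof -
  have qo: "quasiorder le" using assms(1) by (simp add: well_quasiorder_def)
  obtain e where e: "\<And>i j. halts_with (machine e) (\<lambda>_. 0) (\<lambda>_. 0) (prod_encode (i, j)) (if le i j then 1 else 0)"
    using assms(2) unfolding decidable_rel_def by blast
  \<comment> \<open>\<open>m\<close> is fixed first, because the machine \<open>n\<close> has to
    announce this number.\<close>
  obtain m where m: "\<And>q p. machine_fun m q p = Some (inclusion_output e q p)"
    using prog_machine[OF prog_inclusion_output] by blast
  obtain n where n: "\<And>q p. machine_fun n q p = Some (nabla_output e m p)"
    using prog_machine[OF prog_nabla_output] by blast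
  have compact: "points (opens (Av le)) \<subseteq> points (compacts (Av le))"
  proof
    fix U
    assume U: "U \<in> points (opens (Av le))"
    \<comment> \<open>Well-definedness asks only for the existence of generators, which the
      well-quasiorder provides without any name of \<open>U\<close>.\<close>
    obtain B where B: "finite B" "U = {x. \<exists>y\<in>B. le y x}"
      by (rule wqo_finite_basis[OF assms(1) open_Av_upward_closed[OF qo U]])
    obtain xs where "set xs = B" using finite_list[OF B(1)] by blast
    then have "U = {x. \<exists>y\<in>set (list_decode (list_encode xs)). le y x}" using B(2) by simp
    then show "U \<in> points (compacts (Av le))"
      by (rule upward_closure_compact(1)[OF qo e m U, where r = "\<lambda>i. if i = 0 then m else list_encode xs"])
        simp_all
  qed
  have "realizes (machine_fun n (\<lambda>_. 0)) (opens (Av le)) (nabla (compacts (Av le))) (\<lambda>U. U)"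
    unfolding realizes_def
  proof (intro allI impI)
    fix p U
    assume U: "name (opens (Av le)) p U"
    then have pts: "U \<in> points (opens (Av le))" by (simp add: name_opens)
    obtain N r where N: "\<And>k. N \<le> k \<Longrightarrow> basis e p k = basis e p N"
      and r: "Delta (nabla_output e m p) = Some r" "r 0 = m" "\<And>i. r (Suc i) = basis e p N"
      unfolding nabla_output_def[abs_def]
      by (rule Delta_mind_changes[OF finite_basis_changes[OF qo e assms(1)], of p m]) blast
    have "name (compacts (Av le)) r U"
      by (rule upward_closure_compact(2)[OF qo e m pts basis_limit[OF qo e U N] r(2,3)])
    with r(1) n show "\<exists>r. machine_fun n (\<lambda>_. 0) p = Some r \<and> name (nabla (compacts (Av le))) r U"
      by (simp add: nabla_def)
  qed
  moreover have "computable_partial (machine_fun n (\<lambda>_. 0))"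
    unfolding computable_partial_def by (intro exI) (rule map_le_refl)
  ultimately have "computable_between (opens (Av le)) (nabla (compacts (Av le))) (\<lambda>U. U)"
    using compact by (auto simp: computable_between_def nabla_def)
  then show ?thesis
    using compact by (simp add: nabla_computably_Noetherian_def)
qed

end
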